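(* Let $\alpha>3$ and let $QD_{2^\alpha}=\langle a,b\mid a^{2^{\alpha-1}}=b^2=1,\ bab^{-1}=a^{2^{\alpha-2}-1}\rangle$ be the quasi-dihedral group of order $2^\alpha$. Then $\Gamma_N(QD_{2^\alpha})$ is isomorphic to the disjoint union $$\big(K_2+\Gamma_N(D_{2^{\alpha-2}})\big)\cup\big(K_2+\Gamma_N(D_{2^{\alpha-3}})\big),$$ where $D_m=\langle x,y\mid x^m=y^2=1,\ xy=yx^{-1}\rangle$, and for $\alpha=4$ the graph $\Gamma_N(D_2)$ is the graph with no vertices (so the second summand is $K_2$).
   Context: $\Gamma_N(G)$ denotes the simple graph whose vertices are the proper non-normal subgroups of the group $G$, two distinct vertices $H,K$ being adjacent iff $HK=KH$. $K_2$ is the complete graph on two vertices and $G_1+G_2$ is the join (disjoint union plus all edges between $G_1$ and $G_2$). *)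

theory Defs
  imports "HOL-Algebra.Coset" "Graph_Theory.Digraph_Isomorphism" "Graph_Theory.Kuratowski"
begin

section \<open>Groups given by generators and relations\<close>

text \<open>A word over the generating set, which is the whole type \<open>'x\<close>: the letter \<open>(x, True)\<close>
  stands for the generator \<open>x\<close> and \<open>(x, False)\<close> for its formal inverse.\<close>

type_synonym 'x word = "('x \<times> bool) list"

definition gen :: "'x \<Rightarrow> 'x word" where
  "gen x = [(x, True)]"

definition word_inv :: "'x word \<Rightarrow> 'x word" where
  "word_inv w = rev (map (\<lambda>(x, e). (x, \<not> e)) w)"

definition word_pow :: "'x word \<Rightarrow> nat \<Rightarrow> 'x word" where
  "word_pow w n = concat (replicate n w)"

text \<open>A pair \<open>(r, s)\<close> in \<open>R\<close> stands for the relation \<open>r = s\<close>. The predicate is the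
  congruence on words generated by free cancellation and by \<open>R\<close>, so that its classes are the
  elements of the free group modulo the normal closure of all \<open>r s\<^sup>-\<^sup>1\<close>.\<close>

inductive word_eq :: "('x word \<times> 'x word) set \<Rightarrow> 'x word \<Rightarrow> 'x word \<Rightarrow> bool"
  for R where
  refl: "word_eq R u u"
| sym: "word_eq R u v \<Longrightarrow> word_eq R v u"
| trans: "word_eq R u v \<Longrightarrow> word_eq R v w \<Longrightarrow> word_eq R u w"
| cancel: "word_eq R (u @ [(x, e), (x, \<not> e)] @ v) (u @ v)"
| rel: "(r, s) \<in> R \<Longrightarrow> word_eq R (u @ r @ v) (u @ s @ v)"

definition word_class :: "('x word \<times> 'x word) set \<Rightarrow> 'x word \<Rightarrow> 'x word set" where
  "word_class R u = {w. word_eq R u w}"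

definition presented_group :: "('x word \<times> 'x word) set \<Rightarrow> 'x word set monoid" where
  "presented_group R =
    \<lparr> carrier = range (word_class R),
      monoid.mult = (\<lambda>A B. {w. \<exists>u\<in>A. \<exists>v\<in>B. word_eq R (u @ v) w}),
      monoid.one = word_class R [] \<rparr>"

lemma word_eq_context: "word_eq R u v \<Longrightarrow> word_eq R (p @ u @ q) (p @ v @ q)"
proof (induction rule: word_eq.induct)
  case (cancel u x e v)
  show ?case using word_eq.cancel[of R "p @ u" x e "v @ q"] by simp
next
  case (rel r s u v)
  then show ?case using word_eq.rel[of r s R "p @ u" "v @ q"] by simp
qed (blast intro: word_eq.intros)+

lemma word_eq_append:
  assumes "word_eq R u u'" "word_eq R v v'"
  shows "word_eq R (u @ v) (u' @ v')"
  using word_eq_context[OF assms(1), of "[]" v] word_eq_context[OF assms(2), of u' "[]"]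
  by (auto intro: word_eq.trans)

lemma word_class_eq_iff: "word_class R u = word_class R v \<longleftrightarrow> word_eq R u v"
  by (auto simp: word_class_def intro: word_eq.intros)

lemma presented_group_simps:
  "carrier (presented_group R) = range (word_class R)"
  "word_class R u \<otimes>\<^bsub>presented_group R\<^esub> word_class R v = word_class R (u @ v)"
  "\<one>\<^bsub>presented_group R\<^esub> = word_class R []"
  by (auto simp: presented_group_def word_class_def
      intro: word_eq_append word_eq.refl word_eq.sym word_eq.trans)

lemma word_inv_left: "word_eq R (word_inv w @ w) []"
proof (induction w)
  case Nil
  show ?case by (simp add: word_inv_def word_eq.refl)
next
  case (Cons l w)
  obtain x e where l: "l = (x, e)" by fastforce
  have "word_eq R (word_inv w @ [(x, \<not> e), (x, \<not> \<not> e)] @ w) (word_inv w @ w)"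
    by (rule word_eq.cancel)
  then show ?case using Cons l by (auto simp: word_inv_def intro: word_eq.trans)
qed

lemma group_presented_group: "group (presented_group R)"
proof (rule groupI)
  fix A assume "A \<in> carrier (presented_group R)"
  then obtain u where "A = word_class R u" by (auto simp: presented_group_simps)
  then have "word_class R (word_inv u) \<otimes>\<^bsub>presented_group R\<^esub> A = \<one>\<^bsub>presented_group R\<^esub>"
    by (simp add: presented_group_simps word_class_eq_iff word_inv_left)
  then show "\<exists>B\<in>carrier (presented_group R). B \<otimes>\<^bsub>presented_group R\<^esub> A = \<one>\<^bsub>presented_group R\<^esub>"
    by (auto simp: presented_group_simps(1))
qed (auto simp: presented_group_simps)

text \<open>The universal property: a family of elements of a group that satisfies the relations
  extends to a unique homomorphism on the presented group.\<close>

definition word_eval :: "('g, 'm) monoid_scheme \<Rightarrow> ('x \<Rightarrow> 'g) \<Rightarrow> 'x word \<Rightarrow> 'g" where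
  "word_eval H f w =
    foldr (\<lambda>(x, e) g. (if e then f x else inv\<^bsub>H\<^esub> (f x)) \<otimes>\<^bsub>H\<^esub> g) w \<one>\<^bsub>H\<^esub>"

lemma word_eval_closed:
  assumes "group H" "range f \<subseteq> carrier H"
  shows "word_eval H f w \<in> carrier H"
proof -
  interpret group H by fact
  have "f x \<in> carrier H" for x using assms(2) by auto
  then show ?thesis by (induction w) (auto simp: word_eval_def)
qed

lemma word_eval_append:
  assumes "group H" "range f \<subseteq> carrier H"
  shows "word_eval H f (u @ v) = word_eval H f u \<otimes>\<^bsub>H\<^esub> word_eval H f v"
proof -
  interpret group H by fact
  show ?thesis
  proof (induction u)
    case Nil
    show ?case using word_eval_closed[OF assms, of v] by (simp add: word_eval_def)
  next
    case (Cons l u)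
    obtain x e where "l = (x, e)" by fastforce
    moreover have "f x \<in> carrier H" using assms(2) by auto
    ultimately show ?case
      using Cons word_eval_closed[OF assms, of v] word_eval_closed[OF assms, of u]
      by (simp add: word_eval_def m_assoc)
  qed
qed

lemma word_eval_cong:
  assumes "group H" "range f \<subseteq> carrier H"
    and "\<And>r s. (r, s) \<in> R \<Longrightarrow> word_eval H f r = word_eval H f s"
    and "word_eq R u v"
  shows "word_eval H f u = word_eval H f v"
  using assms(4)
proof (induction rule: word_eq.induct)
  case (cancel u x e v)
  interpret group H by fact
  have "f x \<in> carrier H" using assms(2) by auto
  then have "word_eval H f [(x, e), (x, \<not> e)] = \<one>\<^bsub>H\<^esub>" by (simp add: word_eval_def)
  then show ?case using word_eval_closed[OF assms(1,2)]
    by (simp add: word_eval_append[OF assms(1,2)] del: append_Cons append_Nil)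
next
  case (rel r s u v)
  then show ?case using assms(3) by (simp add: word_eval_append[OF assms(1,2)])
qed auto

lemma presented_group_universal:
  assumes "group H" "range f \<subseteq> carrier H"
    and "\<And>r s. (r, s) \<in> R \<Longrightarrow> word_eval H f r = word_eval H f s"
  shows "\<exists>h\<in>hom (presented_group R) H. \<forall>w. h (word_class R w) = word_eval H f w"
proof
  let ?h = "\<lambda>A. word_eval H f (SOME w. A = word_class R w)"
  have h: "?h (word_class R w) = word_eval H f w" for w
  proof -
    have "word_class R w = word_class R (SOME w'. word_class R w = word_class R w')"
      by (rule someI[of _ w]) simp
    then show ?thesis
      using word_eval_cong[OF assms] by (metis word_class_eq_iff)
  qed
  then show "\<forall>w. ?h (word_class R w) = word_eval H f w" by blast
  have "?h (word_class R u \<otimes>\<^bsub>presented_group R\<^esub> word_class R v) =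
      ?h (word_class R u) \<otimes>\<^bsub>H\<^esub> ?h (word_class R v)" for u v
    by (simp only: presented_group_simps h word_eval_append[OF assms(1,2)])
  then show "?h \<in> hom (presented_group R) H"
    by (auto simp: hom_def presented_group_simps(1) word_eval_closed[OF assms(1,2)])
qed

lemma presented_group_hom_unique:
  assumes "group H" "h \<in> hom (presented_group R) H"
  shows "h (word_class R w) = word_eval H (\<lambda>x. h (word_class R (gen x))) w"
proof -
  interpret G: group "presented_group R" by (rule group_presented_group)
  interpret H: group H by fact
  interpret group_hom "presented_group R" H h by unfold_locales fact
  have mem: "word_class R u \<in> carrier (presented_group R)" for u
    by (simp add: presented_group_simps)
  show ?thesis
  proof (induction w)
    case Nil
    show ?case using hom_one by (simp add: word_eval_def presented_group_simps)
  next
    case (Cons l w)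
    obtain x e where l: "l = (x, e)" by fastforce
    have "inv\<^bsub>presented_group R\<^esub> word_class R (gen x) = word_class R [(x, False)]"
      by (rule G.inv_equality)
        (use word_inv_left[of R "gen x"] in
          \<open>simp_all add: mem presented_group_simps(2,3) word_class_eq_iff gen_def word_inv_def\<close>)
    then have "word_class R [l] =
        (if e then word_class R (gen x) else inv\<^bsub>presented_group R\<^esub> word_class R (gen x))"
      by (simp add: l gen_def)
    moreover have "word_class R (l # w) = word_class R [l] \<otimes>\<^bsub>presented_group R\<^esub> word_class R w"
      by (simp add: presented_group_simps)
    ultimately show ?case using Cons mem by (simp add: l word_eval_def)
  qed
qed


section \<open>Dihedral and quasi-dihedral groups\<close>

datatype two_gens = Gen1 | Gen2

text \<open>The dihedral group of order \<open>2 m\<close>, with \<open>x\<close>, \<open>y\<close> rendered as \<open>Gen1\<close>, \<open>Gen2\<close>.\<close>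

definition dihedral_group :: "nat \<Rightarrow> two_gens word set monoid" where
  "dihedral_group m = (let x = gen Gen1; y = gen Gen2 in
    presented_group
      {(word_pow x m, []),
       (word_pow y 2, []),
       (x @ y, y @ word_inv x)})"

text \<open>The quasi-dihedral group of order \<open>2 ^ \<alpha>\<close>, with \<open>a\<close>, \<open>b\<close> rendered as \<open>Gen1\<close>, \<open>Gen2\<close>.\<close>

definition quasidihedral_group :: "nat \<Rightarrow> two_gens word set monoid" where
  "quasidihedral_group \<alpha> = (let a = gen Gen1; b = gen Gen2 in
    presented_group
      {(word_pow a (2 ^ (\<alpha> - 1)), []),
       (word_pow b 2, []),
       (b @ a @ word_inv b, word_pow a (2 ^ (\<alpha> - 2) - 1))})"


section \<open>Graphs\<close>

text \<open>A simple graph is a symmetric loop-free digraph without parallel arcs.\<close>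

definition nonnormal_perm_graph :: "('g, 'm) monoid_scheme \<Rightarrow> 'g set pair_pre_digraph" where
  "nonnormal_perm_graph G = (let V = {H. subgroup H G \<and> H \<noteq> carrier G \<and> \<not> H \<lhd> G} in
    \<lparr> pverts = V,
      parcs = {(H, K). H \<in> V \<and> K \<in> V \<and> H \<noteq> K \<and> H <#>\<^bsub>G\<^esub> K = K <#>\<^bsub>G\<^esub> H} \<rparr>)"

definition complete_graph :: "nat \<Rightarrow> nat pair_pre_digraph" where
  "complete_graph n = \<lparr> pverts = {..<n}, parcs = {(u, v). u < n \<and> v < n \<and> u \<noteq> v} \<rparr>"

definition graph_union ::
    "'a pair_pre_digraph \<Rightarrow> 'b pair_pre_digraph \<Rightarrow> ('a + 'b) pair_pre_digraph" where
  "graph_union G H =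
    \<lparr> pverts = pverts G <+> pverts H,
      parcs = map_prod Inl Inl ` parcs G \<union> map_prod Inr Inr ` parcs H \<rparr>"

definition graph_join ::
    "'a pair_pre_digraph \<Rightarrow> 'b pair_pre_digraph \<Rightarrow> ('a + 'b) pair_pre_digraph" where
  "graph_join G H =
    \<lparr> pverts = pverts G <+> pverts H,
      parcs = parcs (graph_union G H)
        \<union> (Inl ` pverts G) \<times> (Inr ` pverts H) \<union> (Inr ` pverts H) \<times> (Inl ` pverts G) \<rparr>"

text \<open>Every arc of these graphs is its own pair of ends, so a library isomorphism between them
  is an adjacency-preserving and -reflecting bijection of the vertices.\<close>

definition graph_isomorphic :: "'a pair_pre_digraph \<Rightarrow> 'b pair_pre_digraph \<Rightarrow> bool" where
  "graph_isomorphic G H \<longleftrightarrow> digraph_iso (with_proj G) (with_proj H)"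

lemma complete_digraph_complete_graph: "complete_digraph n (with_proj (complete_graph n))"
  unfolding complete_digraph_pair_def by (auto simp: complete_graph_def)

lemma nonnormal_perm_graph_simple: "pair_bidirected_digraph (nonnormal_perm_graph G)"
  by unfold_locales (auto simp: nonnormal_perm_graph_def Let_def symmetric_def sym_def)

lemma graph_union_simple:
  assumes "pair_bidirected_digraph G" "pair_bidirected_digraph H"
  shows "pair_bidirected_digraph (graph_union G H)"
proof -
  interpret G: pair_bidirected_digraph G by fact
  interpret H: pair_bidirected_digraph H by fact
  show ?thesis
    using G.pair_sym_arcs H.pair_sym_arcs
    by unfold_locales
      (auto simp: graph_union_def symmetric_def sym_def
        dest: G.wellformed' H.wellformed' G.pair_no_loops H.pair_no_loops)
qed

lemma graph_join_simple:
  assumes "pair_bidirected_digraph G" "pair_bidirected_digraph H"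
  shows "pair_bidirected_digraph (graph_join G H)"
proof -
  interpret U: pair_bidirected_digraph "graph_union G H" by (rule graph_union_simple[OF assms])
  have "pverts (graph_join G H) = pverts (graph_union G H)"
    by (simp add: graph_join_def graph_union_def)
  then show ?thesis
    using U.pair_sym_arcs
    by unfold_locales
      (auto simp: graph_join_def symmetric_def sym_def
        dest: U.wellformed' U.pair_no_loops)
qed

lemma graph_isomorphic_iff:
  assumes "pair_bidirected_digraph G" "pair_bidirected_digraph H"
  shows "graph_isomorphic G H \<longleftrightarrow>
    (\<exists>f. bij_betw f (pverts G) (pverts H) \<and>
      (\<forall>u\<in>pverts G. \<forall>v\<in>pverts G. (u, v) \<in> parcs G \<longleftrightarrow> (f u, f v) \<in> parcs H))"
    (is "?L \<longleftrightarrow> ?R")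
proof
  interpret G: pair_bidirected_digraph G by fact
  interpret H: pair_bidirected_digraph H by fact
  show ?R if L: ?L
  proof -
    obtain h where h: "pre_digraph.digraph_isomorphism (with_proj G) h"
      and H: "with_proj H = app_iso h (with_proj G)"
      using L unfolding graph_isomorphic_def digraph_iso_def by blast
    let ?f = "iso_verts h"
    have inj: "inj_on ?f (pverts G)"
      and t: "\<And>a. a \<in> parcs G \<Longrightarrow> ?f (fst a) = iso_tail h (iso_arcs h a)"
      and d: "\<And>a. a \<in> parcs G \<Longrightarrow> ?f (snd a) = iso_head h (iso_arcs h a)"
      using h unfolding pre_digraph.digraph_isomorphism_def by auto
    have V: "pverts H = ?f ` pverts G" and A: "parcs H = iso_arcs h ` parcs G"
      and "iso_tail h = fst" "iso_head h = snd"
      using H by (simp_all add: with_proj_def app_iso_def)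
    with t d have "\<And>a. a \<in> parcs G \<Longrightarrow> iso_arcs h a = map_prod ?f ?f a"
      by (simp add: prod_eq_iff)
    then have A': "parcs H = map_prod ?f ?f ` parcs G" using A by auto
    have "(u, v) \<in> parcs G \<longleftrightarrow> (?f u, ?f v) \<in> parcs H"
      if "u \<in> pverts G" "v \<in> pverts G" for u v
    proof
      assume "(?f u, ?f v) \<in> parcs H"
      then obtain u' v' where *: "(u', v') \<in> parcs G" "?f u = ?f u'" "?f v = ?f v'"
        using A' by auto
      then have "u' = u" "v' = v"
        using inj that G.wellformed'[OF *(1)] by (auto dest: inj_onD)
      then show "(u, v) \<in> parcs G" using * by simp
    qed (use A' in force)
    moreover have "bij_betw ?f (pverts G) (pverts H)" using inj V by (simp add: bij_betw_def)
    ultimately show ?R by blast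
  qed
  show ?L if R: ?R
  proof -
    obtain f where f: "bij_betw f (pverts G) (pverts H)"
      and adj: "\<And>u v. u \<in> pverts G \<Longrightarrow> v \<in> pverts G \<Longrightarrow>
        (u, v) \<in> parcs G \<longleftrightarrow> (f u, f v) \<in> parcs H"
      using R by blast
    let ?h = "\<lparr> iso_verts = f, iso_arcs = map_prod f f, iso_head = snd, iso_tail = fst \<rparr>"
    have inj: "inj_on f (pverts G)" and V: "f ` pverts G = pverts H"
      using f by (auto simp: bij_betw_def)
    have "inj_on (map_prod f f) (parcs G)"
      by (rule inj_on_subset[OF map_prod_inj_on[OF inj inj]]) (auto dest: G.wellformed')
    then have "pre_digraph.digraph_isomorphism (with_proj G) ?h"
      unfolding pre_digraph.digraph_isomorphism_def
      using inj G.wf_digraph by auto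
    moreover have "parcs H = map_prod f f ` parcs G"
    proof
      show "parcs H \<subseteq> map_prod f f ` parcs G"
      proof
        fix a assume a: "a \<in> parcs H"
        obtain p q where pq: "a = (p, q)" by fastforce
        then have "p \<in> f ` pverts G" "q \<in> f ` pverts G"
          using a V by (auto dest: H.wellformed')
        then show "a \<in> map_prod f f ` parcs G" using a pq adj by force
      qed
    qed (use adj in \<open>auto dest: G.wellformed'\<close>)
    then have "with_proj H = app_iso ?h (with_proj G)"
      using V by (simp add: with_proj_def app_iso_def)
    ultimately show ?L unfolding graph_isomorphic_def digraph_iso_def by blast
  qed
qed

end

theory Submission
  imports Defs "HOL-Computational_Algebra.Primes"
begin

text \<open>Both kinds of groups consist of elements \<open>a\<^sup>i b\<^sup>e\<close> with \<open>b a = a\<^sup>s b\<close>, where \<open>a\<close> has order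
  \<open>2\<^sup>p\<close> and \<open>s \<equiv> - 1\<close> modulo 4. A subgroup inside \<open>\<langle>a\<rangle>\<close> is normal; every other one is
  \<open>\<langle>a\<^sup>d, a\<^sup>i b\<rangle>\<close> with \<open>d = 2\<^sup>k\<close> and \<open>i\<close> modulo \<open>d\<close>, exists iff \<open>d\<close> divides \<open>(s + 1) i\<close>, and is
  normal iff \<open>d\<close> divides 2. Two of them, with parameters \<open>(d, i)\<close> and \<open>(e, j)\<close>, permute iff
  \<open>min d e\<close> divides \<open>2 (i - j)\<close>. For \<open>d, e \<ge> 4\<close> this forces \<open>i \<equiv> j\<close> modulo 2, so the graph of the
  quasi-dihedral group splits by the parity of \<open>i\<close>, and halving \<open>d\<close> and \<open>i\<close> turns each part into
  the graph of a dihedral group together with the two subgroups with \<open>d = 2\<close>, which permute with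
  everything.\<close>

section \<open>Graph isomorphisms\<close>

text \<open>Naming the vertex map lets isomorphisms be inverted, composed and combined over unions
  and joins before simplicity of the graphs is considered; \<open>graph_isomorphicI\<close> returns
  to the library notion at the end.\<close>

definition graph_iso_map ::
    "('a \<Rightarrow> 'b) \<Rightarrow> 'a pair_pre_digraph \<Rightarrow> 'b pair_pre_digraph \<Rightarrow> bool" where
  "graph_iso_map f G H \<longleftrightarrow> bij_betw f (pverts G) (pverts H) \<and>
    (\<forall>u\<in>pverts G. \<forall>v\<in>pverts G. (u, v) \<in> parcs G \<longleftrightarrow> (f u, f v) \<in> parcs H)"

text \<open>The pair \<open>(k, i)\<close> encodes the subgroup generated by \<open>a\<close> to the power \<open>2\<^sup>k\<close> and \<open>a\<^sup>i b\<close>.\<close>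

definition index_graph :: "(nat \<times> nat) set \<Rightarrow> (nat \<times> nat) pair_pre_digraph" where
  "index_graph V = \<lparr> pverts = V,
     parcs = {((k, i), (l, j)). (k, i) \<in> V \<and> (l, j) \<in> V \<and> (k, i) \<noteq> (l, j)
       \<and> 2 ^ min k l dvd 2 * (int i - int j)} \<rparr>"

lemma Plus_iff: "Inl x \<in> A <+> B \<longleftrightarrow> x \<in> A" "Inr y \<in> A <+> B \<longleftrightarrow> y \<in> B"
  by auto

lemma index_graph_sel:
  "pverts (index_graph V) = V"
  "((k, i), (l, j)) \<in> parcs (index_graph V) \<longleftrightarrow> (k, i) \<in> V \<and> (l, j) \<in> V
    \<and> (k, i) \<noteq> (l, j) \<and> 2 ^ min k l dvd 2 * (int i - int j)"
  by (auto simp: index_graph_def)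

lemma complete_graph_sel:
  "pverts (complete_graph n) = {..<n}"
  "(u, v) \<in> parcs (complete_graph n) \<longleftrightarrow> u < n \<and> v < n \<and> u \<noteq> v"
  by (auto simp: complete_graph_def)

lemma graph_iso_map_trans:
  assumes f: "graph_iso_map f G H" and g: "graph_iso_map g H K"
  shows "graph_iso_map (g \<circ> f) G K"
proof -
  have "bij_betw (g \<circ> f) (pverts G) (pverts K)"
    using f g unfolding graph_iso_map_def by (blast intro: bij_betw_trans)
  moreover have "f u \<in> pverts H" if "u \<in> pverts G" for u
    using f that unfolding graph_iso_map_def by (blast dest: bij_betw_apply)
  ultimately show ?thesis
    using f g unfolding graph_iso_map_def by simp
qed

lemma graph_iso_map_inv:
  assumes f: "graph_iso_map f G H"
  shows "graph_iso_map (inv_into (pverts G) f) H G"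
proof -
  let ?g = "inv_into (pverts G) f"
  have bij: "bij_betw f (pverts G) (pverts H)"
    using f unfolding graph_iso_map_def by blast
  have g: "bij_betw ?g (pverts H) (pverts G)"
    using bij by (rule bij_betw_inv_into)
  moreover have "(u, v) \<in> parcs H \<longleftrightarrow> (?g u, ?g v) \<in> parcs G"
    if "u \<in> pverts H" "v \<in> pverts H" for u v
  proof -
    have "?g u \<in> pverts G" "?g v \<in> pverts G"
      using that bij_betw_apply[OF g] by blast+
    then have "(?g u, ?g v) \<in> parcs G \<longleftrightarrow> (f (?g u), f (?g v)) \<in> parcs H"
      using f unfolding graph_iso_map_def by blast
    then show ?thesis
      using that bij_betw_inv_into_right[OF bij] by simp
  qed
  ultimately show ?thesis
    unfolding graph_iso_map_def by blast
qed

lemma bij_betw_map_sum_Plus: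
  assumes "bij_betw f A A'" "bij_betw g B B'"
  shows "bij_betw (map_sum f g) (A <+> B) (A' <+> B')"
proof -
  have "map_sum f g ` (A <+> B) = f ` A <+> g ` B"
    unfolding Plus_def image_Un image_image by simp
  moreover have "inj_on (map_sum f g) (A <+> B)"
  proof (rule inj_onI)
    fix x y
    assume "x \<in> A <+> B" "y \<in> A <+> B" "map_sum f g x = map_sum f g y"
    then show "x = y"
      using assms by (cases x; cases y) (auto simp: bij_betw_def dest: inj_onD)
  qed
  ultimately show ?thesis
    using assms by (simp add: bij_betw_def)
qed

lemma graph_union_sel:
  "pverts (graph_union G H) = pverts G <+> pverts H"
  "(Inl u, Inl v) \<in> parcs (graph_union G H) \<longleftrightarrow> (u, v) \<in> parcs G"
  "(Inr x, Inr y) \<in> parcs (graph_union G H) \<longleftrightarrow> (x, y) \<in> parcs H"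
  "(Inl u, Inr y) \<notin> parcs (graph_union G H)"
  "(Inr x, Inl v) \<notin> parcs (graph_union G H)"
  by (force simp: graph_union_def)+

lemma graph_join_sel:
  "pverts (graph_join G H) = pverts G <+> pverts H"
  "(Inl u, Inl v) \<in> parcs (graph_join G H) \<longleftrightarrow> (u, v) \<in> parcs G"
  "(Inr x, Inr y) \<in> parcs (graph_join G H) \<longleftrightarrow> (x, y) \<in> parcs H"
  "(Inl u, Inr y) \<in> parcs (graph_join G H) \<longleftrightarrow> u \<in> pverts G \<and> y \<in> pverts H"
  "(Inr x, Inl v) \<in> parcs (graph_join G H) \<longleftrightarrow> x \<in> pverts H \<and> v \<in> pverts G"
  by (auto simp: graph_join_def graph_union_sel)

lemma graph_iso_map_union:
  assumes "graph_iso_map f G G'" "graph_iso_map g H H'"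
  shows "graph_iso_map (map_sum f g) (graph_union G H) (graph_union G' H')"
  using assms bij_betw_map_sum_Plus[of f "pverts G" "pverts G'" g "pverts H" "pverts H'"]
  by (auto simp: graph_iso_map_def graph_union_sel)

lemma graph_iso_map_join:
  assumes "graph_iso_map f G G'" "graph_iso_map g H H'"
  shows "graph_iso_map (map_sum f g) (graph_join G H) (graph_join G' H')"
  using assms bij_betw_map_sum_Plus[of f "pverts G" "pverts G'" g "pverts H" "pverts H'"]
  by (auto simp: graph_iso_map_def graph_join_sel bij_betw_apply)

lemma complete_graph_simple: "pair_bidirected_digraph (complete_graph n)"
  by unfold_locales (auto simp: complete_graph_def symmetric_def sym_def)

lemma graph_isomorphicI:
  assumes "graph_iso_map f G H" "pair_bidirected_digraph G" "pair_bidirected_digraph H"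
  shows "graph_isomorphic G H"
  using assms graph_isomorphic_iff by (auto simp: graph_iso_map_def)

section \<open>Decomposition of the index graphs\<close>

lemma join_complete_graph_index_graph:
  "\<exists>f. graph_iso_map f
    (graph_join (complete_graph 2) (index_graph {(k, i). 2 \<le> k \<and> k \<le> p \<and> i < 2 ^ k}))
    (index_graph {(k, i). 1 \<le> k \<and> k \<le> p \<and> i < 2 ^ k})"
    (is "\<exists>f. graph_iso_map f ?J ?I")
  if p: "p \<ge> 1"
proof
  \<comment> \<open>The two vertices of the complete graph become \<open>(1, 0)\<close> and
    \<open>(1, 1)\<close>. At level 1 the adjacency condition is divisibility of
    \<open>2 * (int i - int j)\<close> by 2, so these two are joined to each other and to everything
    else.\<close>
  let ?f = "case_sum (\<lambda>i. (1, i)) (\<lambda>u. u)"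
  have "bij_betw ?f (pverts ?J) (pverts ?I)"
  proof (rule bij_betwI')
    show "?f x = ?f y \<longleftrightarrow> x = y" if "x \<in> pverts ?J" "y \<in> pverts ?J" for x y
      using that by (cases x; cases y) (auto simp: graph_join_sel index_graph_sel)
    show "?f x \<in> pverts ?I" if "x \<in> pverts ?J" for x
      using that p by (cases x) (auto simp: graph_join_sel complete_graph_sel index_graph_sel)
  next
    fix y assume "y \<in> pverts ?I"
    then obtain k i where y: "y = (k, i)" "1 \<le> k" "k \<le> p" "i < 2 ^ k"
      by (auto simp: index_graph_sel)
    show "\<exists>x\<in>pverts ?J. y = ?f x"
    proof (cases "k = 1")
      case True
      then show ?thesis
        using y by (intro bexI[of _ "Inl i"]) (auto simp: graph_join_sel complete_graph_sel)
    next
      case False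
      then show ?thesis
        using y by (intro bexI[of _ "Inr y"]) (auto simp: graph_join_sel index_graph_sel)
    qed
  qed
  moreover have "(u, v) \<in> parcs ?J \<longleftrightarrow> (?f u, ?f v) \<in> parcs ?I"
    if "u \<in> pverts ?J" "v \<in> pverts ?J" for u v
  proof (cases u; cases v)
    fix i j
    assume "u = Inl i" "v = Inl j"
    then show ?thesis
      using that p by (simp add: graph_join_sel complete_graph_sel index_graph_sel)
  next
    fix i w
    assume "u = Inl i" "v = Inr w"
    then show ?thesis
      using that p by (cases w) (auto simp: graph_join_sel complete_graph_sel index_graph_sel min_def)
  next
    fix j w
    assume "u = Inr w" "v = Inl j"
    then show ?thesis
      using that p by (cases w) (auto simp: graph_join_sel complete_graph_sel index_graph_sel min_def)
  next
    fix w w'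
    assume "u = Inr w" "v = Inr w'"
    then show ?thesis
      using that by (cases w; cases w') (auto simp: graph_join_sel index_graph_sel)
  qed
  ultimately show "graph_iso_map ?f ?J ?I"
    unfolding graph_iso_map_def by blast
qed

text \<open>All levels are at least 2, so adjacency forces 4 to divide twice the difference of the
  indices, and no arc joins an even index to an odd one. Within one parity the difference is twice
  the difference of the halves, so lowering the level by one preserves the condition. Even and odd
  indices have separate bounds because odd indices lose the top level in the quasi-dihedral
  case.\<close>

lemma index_graph_split_parity:
  "graph_iso_map (\<lambda>(k, i). (if even i then Inl else Inr) (k - 1, i div 2))
    (index_graph {(k, i). 2 \<le> k \<and> i < 2 ^ k \<and> (if even i then k \<le> Suc p else k \<le> Suc q)})
    (graph_union (index_graph {(k, i). 1 \<le> k \<and> k \<le> p \<and> i < 2 ^ k})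
      (index_graph {(k, i). 1 \<le> k \<and> k \<le> q \<and> i < 2 ^ k}))"
    (is "graph_iso_map ?f ?I ?U")
proof -
  have half_less: "i div 2 < 2 ^ (k - 1)" if "2 \<le> k" "i < 2 ^ k" for i k :: nat
    using that by (cases k) auto
  have "bij_betw ?f (pverts ?I) (pverts ?U)"
  proof (rule bij_betwI')
    show "?f u = ?f v \<longleftrightarrow> u = v" if "u \<in> pverts ?I" "v \<in> pverts ?I" for u v
    proof -
      obtain k i l j where uv: "u = (k, i)" "v = (l, j)"
        by fastforce
      have "2 \<le> k" "2 \<le> l"
        using that by (auto simp: uv index_graph_sel)
      moreover have "i = j" if "i div 2 = j div 2" "even i = even j"
        using that by presburger
      ultimately show ?thesis
        by (auto simp: uv)
    qed
    show "?f u \<in> pverts ?U" if "u \<in> pverts ?I" for u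
      using that half_less by (auto simp: graph_union_sel index_graph_sel)
    show "\<exists>u\<in>pverts ?I. v = ?f u" if v: "v \<in> pverts ?U" for v
    proof (cases v)
      case (Inl w)
      obtain k i where w: "w = (k, i)"
        by fastforce
      then show ?thesis
        using v Inl by (intro bexI[of _ "(Suc k, 2 * i)"]) (auto simp: graph_union_sel index_graph_sel)
    next
      case (Inr w)
      obtain k i where w: "w = (k, i)"
        by fastforce
      then show ?thesis
        using v Inr by (intro bexI[of _ "(Suc k, Suc (2 * i))"])
          (auto simp: graph_union_sel index_graph_sel)
    qed
  qed
  moreover have "(u, v) \<in> parcs ?I \<longleftrightarrow> (?f u, ?f v) \<in> parcs ?U"
    if u: "u \<in> pverts ?I" and v: "v \<in> pverts ?I" for u v
  proof -
    obtain k i l j where uv: "u = (k, i)" "v = (l, j)"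
      by fastforce
    have kl: "2 \<le> k" "2 \<le> l"
      using u v by (auto simp: uv index_graph_sel)
    \<comment> \<open>The smaller of the two levels after halving is \<open>m\<close>. Since it is
      at least 1, \<open>2 ^ m\<close> is even, which excludes arcs between different
      parities.\<close>
    then obtain m where m: "min k l = Suc m" "min (k - 1) (l - 1) = m" "1 \<le> m"
      by (cases k; cases l) auto
    have dvd: "(2::int) ^ min k l dvd 2 * (int i - int j) \<longleftrightarrow> 2 ^ m dvd int i - int j"
      unfolding m(1) power_Suc by (subst dvd_mult_cancel_left) simp
    have mem: "?f u \<in> pverts ?U" "?f v \<in> pverts ?U"
      using bij_betw_apply[OF \<open>bij_betw ?f (pverts ?I) (pverts ?U)\<close>] u v by blast+
    have ne: "?f u = ?f v \<longleftrightarrow> u = v"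
      using bij_betw_imp_inj_on[OF \<open>bij_betw ?f (pverts ?I) (pverts ?U)\<close>] u v
      by (rule inj_on_eq_iff)
    show ?thesis
    proof (cases "even i \<longleftrightarrow> even j")
      case True
      then have "int i - int j = 2 * (int (i div 2) - int (j div 2))"
        by presburger
      then have "2 ^ min k l dvd 2 * (int i - int j)
          \<longleftrightarrow> 2 ^ m dvd 2 * (int (i div 2) - int (j div 2))"
        using dvd by (simp only:)
      moreover have "(?f u, ?f v) \<in> parcs ?U \<longleftrightarrow>
          ?f u \<noteq> ?f v \<and> 2 ^ m dvd 2 * (int (i div 2) - int (j div 2))"
        using True mem
        by (cases "even i") (simp_all add: uv graph_union_sel index_graph_sel m(2)[simplified] Plus_iff)
      moreover have "(u, v) \<in> parcs ?I \<longleftrightarrow> u \<noteq> v \<and> 2 ^ min k l dvd 2 * (int i - int j)"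
        using u v unfolding uv index_graph_sel by simp
      ultimately show ?thesis
        using ne by simp
    next
      case False
      have "\<not> 2 ^ m dvd int i - int j"
      proof
        assume "2 ^ m dvd int i - int j"
        moreover have "(2::int) dvd 2 ^ m"
          using m by simp
        ultimately have "even (int i - int j)"
          by (rule dvd_trans[rotated])
        then show False
          using False by simp
      qed
      then show ?thesis
        using False dvd by (cases "even i") (simp_all add: uv graph_union_sel index_graph_sel)
    qed
  qed
  ultimately show ?thesis
    unfolding graph_iso_map_def by blast
qed

section \<open>Subgroups of groups of dihedral type\<close>

text \<open>One index for each non-normal subgroup: \<open>2 \<le> k\<close> encodes non-normality,
  \<open>i < 2 ^ k\<close> selects one representative of each residue class, and the divisibility is
  closure under multiplication for the set with parameters \<open>2 ^ k\<close> and
  \<open>i\<close>.\<close>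

definition nonnormal_indices :: "nat \<Rightarrow> int \<Rightarrow> (nat \<times> nat) set" where
  "nonnormal_indices p s = {(k, i). 2 \<le> k \<and> k \<le> p \<and> i < 2 ^ k \<and> 2 ^ k dvd (s + 1) * int i}"

text \<open>Here \<open>\<phi> i e\<close> is the normal form a^i b^e. Exponents range over all
  integers, so products need no reduction and the identification modulo \<open>2 ^ p\<close> is
  confined to \<open>eq_iff\<close>. Both \<open>s = - 1\<close> and
  \<open>s = 2 ^ (\<alpha> - 2) - 1\<close> with \<alpha> > 3 satisfy \<open>twist\<close>, so one
  development serves both families.\<close>

locale dihedral_like = group G for G (structure) +
  fixes p :: nat and s :: int and \<phi> :: "int \<Rightarrow> bool \<Rightarrow> 'a"
  assumes carrier_eq: "carrier G = range (case_prod \<phi>)"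
    and mult: "\<phi> i e \<otimes> \<phi> j f = \<phi> (i + (if e then s * j else j)) (e \<noteq> f)"
    and eq_iff: "\<phi> i e = \<phi> j f \<longleftrightarrow> e = f \<and> 2 ^ p dvd i - j"
    and twist: "4 dvd s + 1"
begin

lemma closed [simp]: "\<phi> i e \<in> carrier G"
  by (auto simp: carrier_eq)

lemma carrierE:
  assumes "x \<in> carrier G"
  obtains i e where "x = \<phi> i e"
  using assms by (auto simp: carrier_eq)

lemma one_eq: "\<one> = \<phi> 0 False"
proof -
  have "\<phi> 0 False \<otimes> \<phi> 0 False = \<phi> 0 False"
    by (simp add: mult)
  then show ?thesis
    using l_cancel_one[of "\<phi> 0 False" "\<phi> 0 False"] by simp
qed

text \<open>The two ways of bracketing the product b b a yield a and a^(s*s), whose exponents must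
  agree modulo \<open>2 ^ p\<close>.\<close>

lemma twist_square: "2 ^ p dvd s * s - 1"
proof -
  have "(\<phi> 0 True \<otimes> \<phi> 0 True) \<otimes> \<phi> 1 False = \<phi> 0 True \<otimes> (\<phi> 0 True \<otimes> \<phi> 1 False)"
    by (rule m_assoc) auto
  then have "\<phi> 1 False = \<phi> (s * s) False"
    by (simp add: mult)
  then show ?thesis
    by (simp add: eq_iff dvd_diff_commute)
qed

lemma inv_rotation: "inv (\<phi> i False) = \<phi> (- i) False"
  by (rule inv_equality) (auto simp: mult one_eq)

lemma inv_reflection: "inv (\<phi> i True) = \<phi> (- s * i) True"
  by (rule inv_equality) (auto simp: mult one_eq)

section \<open>Sets of rotations and reflections: membership, closure, normality\<close>

definition refl_subgroup :: "int \<Rightarrow> int \<Rightarrow> 'a set" where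
  "refl_subgroup d i = {\<phi> x False |x. d dvd x} \<union> {\<phi> x True |x. d dvd x - i}"

context
  fixes d :: int
  assumes d: "d dvd 2 ^ p"
begin

text \<open>An element determines its exponent only modulo \<open>2 ^ p\<close>; since
  \<open>d\<close> divides \<open>2 ^ p\<close>, divisibility by \<open>d\<close> is independent of
  the chosen exponent.\<close>

lemma rotation_in_iff: "\<phi> x False \<in> refl_subgroup d i \<longleftrightarrow> d dvd x"
proof
  assume "\<phi> x False \<in> refl_subgroup d i"
  then obtain y where y: "d dvd y" "2 ^ p dvd x - y"
    by (auto simp: refl_subgroup_def eq_iff)
  then have "d dvd (x - y) + y"
    using d dvd_trans dvd_add by blast
  then show "d dvd x"
    by simp
qed (auto simp: refl_subgroup_def)

lemma reflection_in_iff: "\<phi> x True \<in> refl_subgroup d i \<longleftrightarrow> d dvd x - i"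
proof
  assume "\<phi> x True \<in> refl_subgroup d i"
  then obtain y where y: "d dvd y - i" "2 ^ p dvd x - y"
    by (auto simp: refl_subgroup_def eq_iff)
  then have "d dvd (x - y) + (y - i)"
    using d dvd_trans dvd_add by blast
  then show "d dvd x - i"
    by simp
qed (auto simp: refl_subgroup_def)

text \<open>The square of \<open>\<phi> i True\<close> is the rotation with exponent
  \<open>(s + 1) * i\<close>, which gives necessity. Conversely the condition says that s i is
  congruent to -i modulo \<open>d\<close>, and this suffices to close the set under products and
  inverses.\<close>

lemma subgroup_refl_subgroup_iff:
  "subgroup (refl_subgroup d i) G \<longleftrightarrow> d dvd (s + 1) * i"
proof
  assume "subgroup (refl_subgroup d i) G"
  then have "\<phi> i True \<otimes> \<phi> i True \<in> refl_subgroup d i"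
    by (rule subgroup.m_closed) (auto simp: reflection_in_iff)
  then show "d dvd (s + 1) * i"
    by (simp add: mult rotation_in_iff algebra_simps)
next
  assume i: "d dvd (s + 1) * i"
  show "subgroup (refl_subgroup d i) G"
  proof (rule subgroupI)
    show "refl_subgroup d i \<subseteq> carrier G"
      by (auto simp: refl_subgroup_def)
    have "\<phi> 0 False \<in> refl_subgroup d i"
      by (simp add: rotation_in_iff)
    then show "refl_subgroup d i \<noteq> {}"
      by blast
    have neg: "d dvd - s * x - i" if "d dvd x - i" for x
    proof -
      have "- s * x - i = - s * (x - i) - (s + 1) * i"
        by (simp add: algebra_simps)
      then show ?thesis
        using that i by (metis dvd_diff dvd_mult)
    qed
    show "inv x \<in> refl_subgroup d i" if "x \<in> refl_subgroup d i" for x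
    proof -
      from that consider y where "x = \<phi> y False" "d dvd y" | y where "x = \<phi> y True" "d dvd y - i"
        by (auto simp: refl_subgroup_def)
      then show ?thesis
        by cases (use neg in \<open>auto simp: inv_rotation inv_reflection rotation_in_iff reflection_in_iff\<close>)
    qed
    show "x \<otimes> y \<in> refl_subgroup d i"
      if x: "x \<in> refl_subgroup d i" and y: "y \<in> refl_subgroup d i" for x y
    proof -
      have 1: "d dvd z + w - i" if "d dvd z" "d dvd w - i" for z w
        using dvd_add[OF that] by (simp add: algebra_simps)
      have 2: "d dvd z + s * w" if "d dvd z - i" "d dvd w - i" for z w
      proof -
        have "z + s * w = (z - i) + s * (w - i) + (s + 1) * i"
          by (simp add: algebra_simps)
        then show ?thesis
          using that i by (metis dvd_add dvd_mult)
      qed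
      have 3: "d dvd z + s * w - i" if "d dvd z - i" "d dvd w" for z w
        using 1[of "s * w" z] that by (simp add: add.commute)
      from x y consider
        z w where "x = \<phi> z False" "y = \<phi> w False" "d dvd z" "d dvd w"
        | z w where "x = \<phi> z False" "y = \<phi> w True" "d dvd z" "d dvd w - i"
        | z w where "x = \<phi> z True" "y = \<phi> w False" "d dvd z - i" "d dvd w"
        | z w where "x = \<phi> z True" "y = \<phi> w True" "d dvd z - i" "d dvd w - i"
        unfolding refl_subgroup_def by auto
      then show ?thesis
        by cases (simp_all add: mult rotation_in_iff reflection_in_iff 1 2 3)
    qed
  qed
qed

text \<open>Conjugating \<open>\<phi> i True\<close> by a shifts its exponent by
  \<open>1 - s\<close>, which gives necessity. Conversely, if \<open>s\<close> is 1 modulo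
  \<open>d\<close>, conjugation changes the exponents of reflections in the set only by multiples of
  \<open>d\<close>, while rotations keep exponents divisible by \<open>d\<close>.\<close>

lemma normal_refl_subgroup_iff:
  assumes "subgroup (refl_subgroup d i) G"
  shows "refl_subgroup d i \<lhd> G \<longleftrightarrow> d dvd s - 1"
proof
  assume "refl_subgroup d i \<lhd> G"
  then have "\<phi> 1 False \<otimes> \<phi> i True \<otimes> inv (\<phi> 1 False) \<in> refl_subgroup d i"
    by (rule normal.inv_op_closed2) (auto simp: reflection_in_iff)
  then have "d dvd 1 - s"
    by (simp add: mult inv_rotation reflection_in_iff)
  then show "d dvd s - 1"
    by (simp add: dvd_diff_commute)
next
  assume s: "d dvd s - 1"
  have i: "d dvd (s + 1) * i"
    using assms by (simp add: subgroup_refl_subgroup_iff)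
  have "g \<otimes> h \<otimes> inv g \<in> refl_subgroup d i"
    if g: "g \<in> carrier G" and h: "h \<in> refl_subgroup d i" for g h
  proof -
    obtain j e where ge: "g = \<phi> j e"
      using g by (rule carrierE)
    from h consider y where "h = \<phi> y False" "d dvd y" | y where "h = \<phi> y True" "d dvd y - i"
      by (auto simp: refl_subgroup_def)
    then show ?thesis
    proof cases
      case 1
      have "d dvd j + s * y + s * (- s * j)"
      proof -
        have "d dvd s * s - 1"
          using d twist_square dvd_trans by blast
        moreover have "j + s * y + s * (- s * j) = s * y - (s * s - 1) * j"
          by (simp add: algebra_simps)
        ultimately show ?thesis
          using 1 by (metis dvd_diff dvd_mult dvd_mult2)
      qed
      then show ?thesis
        using 1 by (cases e) (auto simp: ge mult inv_rotation inv_reflection rotation_in_iff)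
    next
      case 2
      have "j + y + s * - j - i = (y - i) - (s - 1) * j"
        "j + s * y + (- s * j) - i = (y - i) + (s - 1) * (y - j)"
        by (simp_all add: algebra_simps)
      then have "d dvd j + y + s * - j - i" "d dvd j + s * y + (- s * j) - i"
        using 2 s by (metis dvd_diff dvd_mult2, metis dvd_add dvd_mult2)
      then show ?thesis
        by (cases e) (auto simp: ge 2 mult inv_rotation inv_reflection reflection_in_iff)
    qed
  qed
  then show "refl_subgroup d i \<lhd> G"
    using assms by (simp add: normal_inv_iff)
qed

end

section \<open>Equality and permutability of two such subgroups\<close>

lemma refl_subgroup_eq_iff:
  assumes "d dvd 2 ^ p" "d' dvd 2 ^ p" "0 \<le> d" "0 \<le> d'"
  shows "refl_subgroup d i = refl_subgroup d' i' \<longleftrightarrow> d = d' \<and> d dvd i - i'"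
proof
  assume eq: "refl_subgroup d i = refl_subgroup d' i'"
  have "d dvd x \<longleftrightarrow> d' dvd x" for x
    using eq assms rotation_in_iff by metis
  \<comment> \<open>The rotations determine \<open>d\<close> up to sign, which the sign assumptions
    fix; the reflections then determine \<open>i\<close> modulo \<open>d\<close>.\<close>
  then have "d = d'"
    using assms zdvd_antisym_nonneg[of d d'] by (metis dvd_refl)
  moreover have "\<phi> i True \<in> refl_subgroup d' i'"
    using eq assms reflection_in_iff[of d i i] by simp
  ultimately show "d = d' \<and> d dvd i - i'"
    using assms by (simp add: reflection_in_iff)
next
  assume *: "d = d' \<and> d dvd i - i'"
  have "d dvd x - i \<longleftrightarrow> d dvd x - i'" for x
    using conjunct2[OF *] dvd_add_left_iff[of d "i - i'" "x - i"] by (simp add: algebra_simps)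
  then show "refl_subgroup d i = refl_subgroup d' i'"
    using * by (simp add: refl_subgroup_def)
qed

text \<open>Since \<open>d\<close> divides \<open>e\<close>, everything can be computed modulo
  \<open>d\<close>. The product HK consists of the rotations with exponent 0 or i - j and the
  reflections with exponent i or j, all modulo \<open>d\<close>; exchanging the factors only turns i
  - j into j - i.\<close>

lemma refl_subgroup_mult_commute_iff:
  assumes e: "e dvd 2 ^ p" and de: "d dvd e"
    and H: "subgroup (refl_subgroup d i) G" and K: "subgroup (refl_subgroup e j) G"
  shows "refl_subgroup d i <#> refl_subgroup e j = refl_subgroup e j <#> refl_subgroup d i
    \<longleftrightarrow> d dvd 2 * (i - j)" (is "?HK = ?KH \<longleftrightarrow> _")
proof -
  have d: "d dvd 2 ^ p"
    using de e by (rule dvd_trans)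
  have i: "d dvd (s + 1) * i" and j: "d dvd (s + 1) * j"
    using H K d e de by (auto simp: subgroup_refl_subgroup_iff intro: dvd_trans)
  have dvd_combine: "d dvd x + s * y - (i - j)"
    if "d dvd x - i" "d dvd y - j" for x y
  proof -
    have "x + s * y - (i - j) = (x - i) + s * (y - j) + (s + 1) * j"
      by (simp add: algebra_simps)
    then show ?thesis
      using that j by (metis dvd_add dvd_mult)
  qed
  have HK_rotation: "d dvd x \<or> d dvd x - (i - j)" if x: "\<phi> x False \<in> ?HK" for x
  proof -
    obtain h k where hk: "h \<in> refl_subgroup d i" "k \<in> refl_subgroup e j" "\<phi> x False = h \<otimes> k"
      using x by (auto simp: set_mult_def)
    from hk(1,2) consider y z where "h = \<phi> y False" "k = \<phi> z False" "d dvd y" "d dvd z"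
      | y z f where "h = \<phi> y f" "k = \<phi> z (\<not> f)"
      | y z where "h = \<phi> y True" "k = \<phi> z True" "d dvd y - i" "d dvd z - j"
      using de unfolding refl_subgroup_def by (auto intro: dvd_trans)
    then show ?thesis
    proof cases
      case 1
      then have "d dvd x - (y + z)" "d dvd y + z"
        using hk(3) d by (auto simp: mult eq_iff intro: dvd_trans)
      then show ?thesis
        using dvd_add[of d "x - (y + z)" "y + z"] by simp
    next
      case 2
      then show ?thesis
        using hk(3) by (auto simp: mult eq_iff)
    next
      case 3
      then have "d dvd x - (y + s * z)" "d dvd y + s * z - (i - j)"
        using hk(3) d dvd_combine by (auto simp: mult eq_iff intro: dvd_trans)
      then show ?thesis
        using dvd_add[of d "x - (y + s * z)" "y + s * z - (i - j)"] by (simp add: algebra_simps)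
    qed
  qed
  have HK_I: "h \<otimes> k \<in> ?HK" if "h \<in> refl_subgroup d i" "k \<in> refl_subgroup e j" for h k
    using that by (auto simp: set_mult_def)
  have rotation_in_HK: "\<phi> x False \<in> ?HK" if "d dvd x \<or> d dvd x - (i - j)" for x
    using that
  proof
    assume "d dvd x"
    then show ?thesis
      using HK_I[of "\<phi> x False" "\<phi> 0 False"] d e by (simp add: mult rotation_in_iff)
  next
    assume "d dvd x - (i - j)"
    \<comment> \<open>Splitting off \<open>\<phi> j True\<close> on the right leaves the reflection
      with exponent \<open>x - s * j\<close>. It lies in the first subgroup because s j is congruent
      to -j modulo \<open>d\<close>.\<close>
    moreover have "x - s * j - i = x - (i - j) - (s + 1) * j"
      by (simp add: algebra_simps)
    ultimately have "d dvd x - s * j - i"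
      using j by (metis dvd_diff)
    then show ?thesis
      using HK_I[of "\<phi> (x - s * j) True" "\<phi> j True"] d e by (simp add: mult reflection_in_iff)
  qed
  have reflection_in_HK: "\<phi> x True \<in> ?HK" if "d dvd x - i \<or> d dvd x - j" for x
    using that
  proof
    assume "d dvd x - i"
    then show ?thesis
      using HK_I[of "\<phi> x True" "\<phi> 0 False"] d e
      by (simp add: mult reflection_in_iff rotation_in_iff)
  next
    assume "d dvd x - j"
    then show ?thesis
      using HK_I[of "\<phi> (x - j) False" "\<phi> j True"] d e
      by (simp add: mult reflection_in_iff rotation_in_iff)
  qed
  show ?thesis
  proof
    assume eq: "?HK = ?KH"
    \<comment> \<open>This product is a rotation whose exponent is j - i modulo \<open>d\<close>.
      Lying in HK, the exponent must be 0 or i - j, and either way \<open>d\<close> divides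
      \<open>2 * (i - j)\<close>.\<close>
    have "\<phi> j True \<otimes> \<phi> i True \<in> ?KH"
      using d e reflection_in_iff[of d i i] reflection_in_iff[of e j j]
      unfolding set_mult_def by auto
    then have "d dvd j + s * i \<or> d dvd j + s * i - (i - j)"
      unfolding eq[symmetric] by (intro HK_rotation) (simp add: mult)
    moreover have "2 * (i - j) = 2 * ((s + 1) * i - (j + s * i))"
      "2 * (i - j) = (s + 1) * i - (j + s * i - (i - j))"
      by (simp_all add: algebra_simps)
    ultimately show "d dvd 2 * (i - j)"
      using i by (metis dvd_diff dvd_mult)
  next
    assume ij: "d dvd 2 * (i - j)"
    have "?KH \<subseteq> ?HK"
    proof
      fix g
      assume "g \<in> ?KH"
      then obtain k h where hk: "h \<in> refl_subgroup d i" "k \<in> refl_subgroup e j" "g = k \<otimes> h"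
        by (auto simp: set_mult_def)
      from hk(1,2) consider
        y z where "k = \<phi> y False" "h = \<phi> z False" "d dvd y" "d dvd z"
        | y z where "k = \<phi> y False" "h = \<phi> z True" "d dvd y" "d dvd z - i"
        | y z where "k = \<phi> y True" "h = \<phi> z False" "d dvd y - j" "d dvd z"
        | y z where "k = \<phi> y True" "h = \<phi> z True" "d dvd y - j" "d dvd z - i"
        using de unfolding refl_subgroup_def by (auto intro: dvd_trans)
      then show "g \<in> ?HK"
      proof cases
        case 1
        then show ?thesis
          using rotation_in_HK[of "y + z"] by (simp add: hk mult)
      next
        case 2
        then show ?thesis
          using reflection_in_HK[of "y + z"] dvd_add[of d y "z - i"]
          by (simp add: hk mult algebra_simps)
      next
        case 3
        then show ?thesis
          using reflection_in_HK[of "y + s * z"] dvd_add[of d "y - j" "s * z"]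
          by (simp add: hk mult algebra_simps)
      next
        case 4
        have "y + s * z - (i - j) = (y - j) + s * (z - i) + (s + 1) * i - 2 * (i - j)"
          by (simp add: algebra_simps)
        then have "d dvd y + s * z - (i - j)"
          using 4 i ij by (metis dvd_add dvd_diff dvd_mult)
        then show ?thesis
          using 4 rotation_in_HK[of "y + s * z"] by (simp add: hk mult)
      qed
    qed
    \<comment> \<open>Inversion exchanges HK and KH, so this inclusion follows from the other one
      applied to the inverse of \<open>g\<close>.\<close>
    moreover have "?HK \<subseteq> ?KH"
    proof
      fix g
      assume g: "g \<in> ?HK"
      then obtain h k where hk: "h \<in> refl_subgroup d i" "k \<in> refl_subgroup e j" "g = h \<otimes> k"
        by (auto simp: set_mult_def)
      have mem: "h \<in> carrier G" "k \<in> carrier G"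
        using hk H K by (auto dest: subgroup.mem_carrier)
      have "inv g = inv k \<otimes> inv h"
        using mem by (simp add: hk inv_mult_group)
      moreover have "inv k \<in> refl_subgroup e j" "inv h \<in> refl_subgroup d i"
        using hk H K by (auto intro: subgroup.m_inv_closed)
      ultimately have "inv g \<in> ?KH"
        by (auto simp: set_mult_def)
      with \<open>?KH \<subseteq> ?HK\<close> obtain h' k'
        where hk': "h' \<in> refl_subgroup d i" "k' \<in> refl_subgroup e j" "inv g = h' \<otimes> k'"
        unfolding set_mult_def by blast
      have mem': "h' \<in> carrier G" "k' \<in> carrier G"
        using hk' H K by (auto dest: subgroup.mem_carrier)
      have "g = inv (inv g)"
        using mem hk by simp
      also have "\<dots> = inv k' \<otimes> inv h'"
        using mem' by (simp add: hk' inv_mult_group)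
      finally show "g \<in> ?KH"
        using hk' H K unfolding set_mult_def by (blast intro: subgroup.m_inv_closed)
    qed
    ultimately show "?HK = ?KH"
      by blast
  qed
qed

section \<open>Classification of the subgroups\<close>

lemma normal_if_no_reflections:
  assumes H: "subgroup H G" and "\<And>i. \<phi> i True \<notin> H"
  shows "H \<lhd> G"
proof -
  have "g \<otimes> h \<otimes> inv g \<in> H" if g: "g \<in> carrier G" and h: "h \<in> H" for g h
  proof -
    obtain j e where ge: "g = \<phi> j e"
      using g by (rule carrierE)
    have "h \<in> carrier G"
      using H h by (rule subgroup.mem_carrier)
    then obtain x where hx: "h = \<phi> x False"
      using h assms(2) by (metis (full_types) carrierE)
    have power: "\<phi> (int n * x) False \<in> H" for n
    proof (induction n)
      case 0
      show ?case
        using subgroup.one_closed[OF H] by (simp add: one_eq)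
    next
      case (Suc n)
      then have "\<phi> (int n * x) False \<otimes> h \<in> H"
        using H h by (auto intro: subgroup.m_closed)
      then show ?case
        by (simp add: hx mult algebra_simps)
    qed
    show ?thesis
    proof (cases e)
      case True
      \<comment> \<open>Conjugation by a reflection raises a rotation to the power \<open>s\<close>.
        As \<open>s\<close> may be negative while \<open>power\<close> covers natural multiples,
        \<open>s\<close> is replaced by its residue modulo \<open>2 ^ p\<close>.\<close>
      let ?n = "nat (s mod 2 ^ p)"
      have "g \<otimes> h \<otimes> inv g = \<phi> (j + s * x - s * s * j) False"
        by (simp add: ge hx True mult inv_reflection algebra_simps)
      also have "\<dots> = \<phi> (int ?n * x) False"
      proof -
        have "j + s * x - s * s * j - int ?n * x = (s - s mod 2 ^ p) * x - (s * s - 1) * j"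
          by (simp add: algebra_simps)
        moreover have "2 ^ p dvd s - s mod 2 ^ p"
          by (simp add: dvd_minus_mod)
        ultimately have "2 ^ p dvd j + s * x - s * s * j - int ?n * x"
          using twist_square by (metis dvd_diff dvd_mult2)
        then show ?thesis
          by (simp add: eq_iff)
      qed
      finally show ?thesis
        using power[of ?n] by simp
    next
      case False
      then show ?thesis
        using h by (simp add: ge hx mult inv_rotation)
    qed
  qed
  then show ?thesis
    using H by (simp add: normal_inv_iff)
qed

text \<open>With \<open>d\<close> the least positive rotation exponent in \<open>H\<close>, division
  with remainder shows that the rotations in \<open>H\<close> are those with exponent divisible by
  \<open>d\<close>. Multiplication by \<open>\<phi> i True\<close> carries them to the reflections
  in \<open>H\<close>. The rotation with exponent \<open>2 ^ p\<close> is the identity, so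
  \<open>d\<close> divides \<open>2 ^ p\<close> and is a power of two.\<close>

lemma subgroup_with_reflection:
  assumes H: "subgroup H G" and i: "\<phi> i True \<in> H"
  obtains k where "k \<le> p" "H = refl_subgroup (2 ^ k) i"
proof -
  let ?P = "\<lambda>n. 0 < n \<and> \<phi> (int n) False \<in> H"
  define d where "d = (LEAST n. ?P n)"
  have "\<phi> (2 ^ p) False = \<one>"
    by (simp add: one_eq eq_iff)
  then have "?P (2 ^ p)"
    using subgroup.one_closed[OF H] by simp
  then have d: "?P d"
    unfolding d_def by (rule LeastI)
  have add: "\<phi> (x + y) False \<in> H" if "\<phi> x False \<in> H" "\<phi> y False \<in> H" for x y
    using subgroup.m_closed[OF H that] by (simp add: mult)
  have neg: "\<phi> (- x) False \<in> H" if "\<phi> x False \<in> H" for x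
    using subgroup.m_inv_closed[OF H that] by (simp add: inv_rotation)
  have nat_multiple: "\<phi> (int n * int d) False \<in> H" for n
  proof (induction n)
    case 0
    show ?case
      using subgroup.one_closed[OF H] by (simp add: one_eq)
  next
    case (Suc n)
    then show ?case
      using add[of "int n * int d" "int d"] d by (simp add: algebra_simps)
  qed
  have multiple: "\<phi> (q * int d) False \<in> H" for q
    using nat_multiple[of "nat q"] neg[OF nat_multiple[of "nat (- q)"]]
    by (cases "q \<ge> 0") simp_all
  have rotation: "\<phi> x False \<in> H \<longleftrightarrow> int d dvd x" for x
  proof
    assume x: "\<phi> x False \<in> H"
    have "x mod int d = x + - (x div int d) * int d"
      by (simp add: minus_div_mult_eq_mod)
    then have "\<phi> (x mod int d) False \<in> H"
      using add[OF x multiple] by metis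
    moreover have "nat (x mod int d) < d"
      using d by (simp add: nat_less_iff)
    then have "\<not> ?P (nat (x mod int d))"
      unfolding d_def by (rule not_less_Least)
    moreover have "x mod int d \<ge> 0"
      using d by simp
    ultimately have "x mod int d = 0"
      by auto
    then show "int d dvd x"
      by (simp add: dvd_eq_mod_eq_0)
  next
    assume "int d dvd x"
    then show "\<phi> x False \<in> H"
      using multiple by (auto simp: mult.commute elim!: dvdE)
  qed
  have reflection: "\<phi> x True \<in> H \<longleftrightarrow> int d dvd x - i" for x
  proof
    assume "\<phi> x True \<in> H"
    then have "\<phi> x True \<otimes> inv (\<phi> i True) \<in> H"
      using H i by (auto intro: subgroup.m_closed subgroup.m_inv_closed)
    \<comment> \<open>The computed exponent is \<open>x - s * s * i\<close>, which
      \<open>twist_square\<close> identifies with \<open>x - i\<close> modulo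
      \<open>2 ^ p\<close>.\<close>
    moreover have "\<phi> x True \<otimes> inv (\<phi> i True) = \<phi> (x - i) False"
    proof -
      have "x - s * s * i - (x - i) = - i * (s * s - 1)"
        by (simp add: algebra_simps)
      then have "2 ^ p dvd x - s * s * i - (x - i)"
        using twist_square by (metis dvd_mult)
      then show ?thesis
        by (simp add: inv_reflection mult eq_iff algebra_simps)
    qed
    ultimately show "int d dvd x - i"
      by (simp add: rotation)
  next
    assume "int d dvd x - i"
    then have "\<phi> (x - i) False \<otimes> \<phi> i True \<in> H"
      using H i rotation by (auto intro: subgroup.m_closed)
    then show "\<phi> x True \<in> H"
      by (simp add: mult)
  qed
  have "int d dvd int (2 ^ p)"
    using rotation[of "2 ^ p"] \<open>?P (2 ^ p)\<close> by simp
  then have "d dvd 2 ^ p"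
    by (simp only: int_dvd_int_iff)
  then obtain k where k: "k \<le> p" "d = 2 ^ k"
    using divides_primepow_nat[OF two_is_prime_nat, of d p] by blast
  have "H = refl_subgroup (2 ^ k) i"
  proof
    show "H \<subseteq> refl_subgroup (2 ^ k) i"
    proof
      fix h
      assume h: "h \<in> H"
      then obtain x e where "h = \<phi> x e"
        using subgroup.mem_carrier[OF H] carrierE by blast
      then show "h \<in> refl_subgroup (2 ^ k) i"
        using h rotation[of x] reflection[of x]
        by (cases e) (auto simp: refl_subgroup_def k)
    qed
    show "refl_subgroup (2 ^ k) i \<subseteq> H"
      using rotation reflection by (auto simp: refl_subgroup_def k)
  qed
  then show thesis
    using k that by blast
qed

text \<open>By \<open>twist\<close>, \<open>s - 1\<close> is 2 modulo 4, so it contains exactly one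
  factor 2. This turns the normality criterion into a bound on the level.\<close>

lemma dvd_twist_minus_one_iff:
  "2 ^ k dvd s - 1 \<longleftrightarrow> k < 2"
proof
  assume k: "2 ^ k dvd s - 1"
  show "k < 2"
  proof (rule ccontr)
    assume "\<not> k < 2"
    then have "(2::int) ^ 2 dvd 2 ^ k"
      by (intro le_imp_power_dvd) simp
    then have "4 dvd s - 1"
      using k by (auto intro: dvd_trans)
    then show False
      using twist by presburger
  qed
next
  assume "k < 2"
  then consider "k = 0" | "k = 1"
    by linarith
  then show "2 ^ k dvd s - 1"
    by cases (use twist in \<open>simp, simp, presburger\<close>)
qed

section \<open>Vertices and adjacency of the graph\<close>

lemma pverts_nonnormal_perm_graph:
  "pverts (nonnormal_perm_graph G)
    = (\<lambda>(k, i). refl_subgroup (2 ^ k) (int i)) ` nonnormal_indices p s"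
proof (intro equalityI subsetI)
  fix H
  assume "H \<in> pverts (nonnormal_perm_graph G)"
  then have H: "subgroup H G" and nn: "\<not> H \<lhd> G"
    by (auto simp: nonnormal_perm_graph_def Let_def)
  then obtain i where "\<phi> i True \<in> H"
    using normal_if_no_reflections by blast
  with H obtain k where k: "k \<le> p" "H = refl_subgroup (2 ^ k) i"
    by (rule subgroup_with_reflection)
  have dvd: "(2::int) ^ k dvd 2 ^ p"
    using k by (simp add: le_imp_power_dvd)
  let ?i = "nat (i mod 2 ^ k)"
  have "H = refl_subgroup (2 ^ k) (int ?i)"
    using k dvd by (simp add: refl_subgroup_eq_iff dvd_minus_mod)
  moreover have "(k, ?i) \<in> nonnormal_indices p s"
  proof -
    have "\<not> k < 2"
      using nn H k dvd dvd_twist_minus_one_iff normal_refl_subgroup_iff by auto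
    moreover have "2 ^ k dvd (s + 1) * int ?i"
      using H subgroup_refl_subgroup_iff[OF dvd] calculation \<open>H = refl_subgroup (2 ^ k) (int ?i)\<close>
      by simp
    ultimately show ?thesis
      using k by (simp add: nonnormal_indices_def nat_less_iff)
  qed
  ultimately show "H \<in> (\<lambda>(k, i). refl_subgroup (2 ^ k) (int i)) ` nonnormal_indices p s"
    by force
next
  fix H
  assume "H \<in> (\<lambda>(k, i). refl_subgroup (2 ^ k) (int i)) ` nonnormal_indices p s"
  then obtain k i where ki: "(k, i) \<in> nonnormal_indices p s" "H = refl_subgroup (2 ^ k) (int i)"
    by auto
  have dvd: "(2::int) ^ k dvd 2 ^ p"
    using ki by (simp add: nonnormal_indices_def le_imp_power_dvd)
  have H: "subgroup H G"
    using ki dvd by (simp add: nonnormal_indices_def subgroup_refl_subgroup_iff)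
  have nn: "\<not> H \<lhd> G"
    using ki H dvd normal_refl_subgroup_iff dvd_twist_minus_one_iff by (auto simp: nonnormal_indices_def)
  \<comment> \<open>The whole group is normal, so a non-normal subgroup is proper.\<close>
  moreover have "carrier G \<lhd> G"
    by (simp add: normal_inv_iff subgroup_self)
  ultimately show "H \<in> pverts (nonnormal_perm_graph G)"
    using H by (auto simp: nonnormal_perm_graph_def Let_def)
qed

lemma graph_iso_map_index_graph:
  "graph_iso_map (\<lambda>(k, i). refl_subgroup (2 ^ k) (int i)) (index_graph (nonnormal_indices p s))
    (nonnormal_perm_graph G)"
proof -
  let ?f = "\<lambda>(k, i). refl_subgroup (2 ^ k) (int i)"
  have eq: "refl_subgroup (2 ^ k) (int i) = refl_subgroup (2 ^ l) (int j) \<longleftrightarrow> (k, i) = (l, j)"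
    if "(k, i) \<in> nonnormal_indices p s" "(l, j) \<in> nonnormal_indices p s" for k i l j
  proof -
    have "i = j" if "2 ^ k dvd int i - int j" "i < 2 ^ k" "j < 2 ^ k"
    proof -
      have "int i mod 2 ^ k = int j mod 2 ^ k"
        using that by (simp only: mod_eq_dvd_iff)
      then show ?thesis
        using that by simp
    qed
    then show ?thesis
      using that by (auto simp: nonnormal_indices_def refl_subgroup_eq_iff le_imp_power_dvd)
  qed
  have "inj_on ?f (nonnormal_indices p s)"
    using eq by (auto simp: inj_on_def)
  then have bij: "bij_betw ?f (nonnormal_indices p s) (pverts (nonnormal_perm_graph G))"
    by (simp add: bij_betw_def pverts_nonnormal_perm_graph)
  have commute: "refl_subgroup (2 ^ k) (int i) <#> refl_subgroup (2 ^ l) (int j)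
      = refl_subgroup (2 ^ l) (int j) <#> refl_subgroup (2 ^ k) (int i)
    \<longleftrightarrow> 2 ^ k dvd 2 * (int i - int j)"
    if "(k, i) \<in> nonnormal_indices p s" "(l, j) \<in> nonnormal_indices p s" "k \<le> l" for k i l j
    using that
    by (intro refl_subgroup_mult_commute_iff)
      (auto simp: nonnormal_indices_def le_imp_power_dvd subgroup_refl_subgroup_iff)
  have "(refl_subgroup (2 ^ k) (int i), refl_subgroup (2 ^ l) (int j))
      \<in> parcs (nonnormal_perm_graph G) \<longleftrightarrow> ((k, i), (l, j)) \<in> parcs (index_graph (nonnormal_indices p s))"
    if ki: "(k, i) \<in> nonnormal_indices p s" and lj: "(l, j) \<in> nonnormal_indices p s" for k i l j
  proof -
    have "refl_subgroup (2 ^ k) (int i) \<in> pverts (nonnormal_perm_graph G)"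
      "refl_subgroup (2 ^ l) (int j) \<in> pverts (nonnormal_perm_graph G)"
      using ki lj by (auto simp: pverts_nonnormal_perm_graph)
    then have "(refl_subgroup (2 ^ k) (int i), refl_subgroup (2 ^ l) (int j))
        \<in> parcs (nonnormal_perm_graph G) \<longleftrightarrow> (k, i) \<noteq> (l, j)
        \<and> refl_subgroup (2 ^ k) (int i) <#> refl_subgroup (2 ^ l) (int j)
          = refl_subgroup (2 ^ l) (int j) <#> refl_subgroup (2 ^ k) (int i)"
      using eq[OF ki lj] by (auto simp: nonnormal_perm_graph_def Let_def)
    also have "\<dots> \<longleftrightarrow> (k, i) \<noteq> (l, j) \<and> 2 ^ min k l dvd 2 * (int i - int j)"
    proof (cases "k \<le> l")
      case True
      then show ?thesis
        using commute[OF ki lj] by (simp add: min_def)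
    next
      \<comment> \<open>The criterion \<open>commute\<close> expects the lower level first, so the
        two subgroups are exchanged.\<close>
      case False
      then have "2 ^ l dvd 2 * (int j - int i) \<longleftrightarrow> 2 ^ min k l dvd 2 * (int i - int j)"
        by (metis dvd_minus_iff min.absorb2 minus_diff_eq mult_minus_right nle_le)
      then show ?thesis
        using False commute[OF lj ki] by (simp add: eq_commute)
    qed
    also have "\<dots> \<longleftrightarrow> ((k, i), (l, j)) \<in> parcs (index_graph (nonnormal_indices p s))"
      using ki lj by (simp add: index_graph_def)
    finally show ?thesis .
  qed
  then show ?thesis
    using bij by (auto simp: graph_iso_map_def index_graph_def)
qed

end

section \<open>The presented groups\<close>

text \<open>A concrete semidirect product onto which the presented groups map, which shows that the
  relations force no further collapse.\<close>

definition twisted_group :: "int \<Rightarrow> int \<Rightarrow> (int \<times> bool) monoid" where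
  "twisted_group n s =
    \<lparr> carrier = {0..<n} \<times> UNIV,
      monoid.mult = (\<lambda>(i, e) (j, f). ((i + (if e then s * j else j)) mod n, e \<noteq> f)),
      monoid.one = (0, False) \<rparr>"

lemma twisted_group_sel:
  "carrier (twisted_group n s) = {0..<n} \<times> UNIV"
  "(i, e) \<otimes>\<^bsub>twisted_group n s\<^esub> (j, f) = ((i + (if e then s * j else j)) mod n, e \<noteq> f)"
  "\<one>\<^bsub>twisted_group n s\<^esub> = (0, False)"
  by (simp_all add: twisted_group_def)

lemma group_twisted_group:
  assumes n: "n > 0" and s: "n dvd s * s - 1"
  shows "group (twisted_group n s)"
proof (rule groupI)
  fix x y z
  assume "x \<in> carrier (twisted_group n s)" "y \<in> carrier (twisted_group n s)"
    "z \<in> carrier (twisted_group n s)"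
  obtain i e j f k g where xyz: "x = (i, e)" "y = (j, f)" "z = (k, g)"
    by (metis surj_pair)
  \<comment> \<open>When the first two factors are both reflections, one bracketing multiplies the
    third exponent by \<open>s\<close> twice; the hypothesis on \<open>s * s\<close> absorbs
    this.\<close>
  have "(i + s * j + k) mod n = (i + s * (j + s * k)) mod n"
  proof -
    have "i + s * j + k - (i + s * (j + s * k)) = - k * (s * s - 1)"
      by (simp add: algebra_simps)
    then show ?thesis
      unfolding mod_eq_dvd_iff using s by (metis dvd_mult)
  qed
  then have "((i + s * j) mod n + k) mod n = (i + s * ((j + s * k) mod n)) mod n"
    by (metis mod_add_left_eq mod_add_right_eq mod_mult_right_eq)
  moreover have "((i + s * j) mod n + s * k) mod n = (i + s * ((j + k) mod n)) mod n"
    by (metis add.assoc distrib_left mod_add_left_eq mod_add_right_eq mod_mult_right_eq)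
  ultimately show "x \<otimes>\<^bsub>twisted_group n s\<^esub> y \<otimes>\<^bsub>twisted_group n s\<^esub> z =
      x \<otimes>\<^bsub>twisted_group n s\<^esub> (y \<otimes>\<^bsub>twisted_group n s\<^esub> z)"
    by (cases e; cases f) (simp_all add: xyz twisted_group_sel mod_simps add.assoc)
next
  fix x
  assume "x \<in> carrier (twisted_group n s)"
  then obtain i e where x: "x = (i, e)" "0 \<le> i" "i < n"
    by (auto simp: twisted_group_sel)
  show "\<exists>y\<in>carrier (twisted_group n s). y \<otimes>\<^bsub>twisted_group n s\<^esub> x = \<one>\<^bsub>twisted_group n s\<^esub>"
    by (rule bexI[of _ "((if e then - s * i else - i) mod n, e)"])
      (use n in \<open>auto simp: x twisted_group_sel mod_simps\<close>)
qed (use n in \<open>auto simp: twisted_group_sel\<close>)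

lemma (in group) conj_int_pow:
  assumes a: "a \<in> carrier G" and b: "b \<in> carrier G" and ba: "b \<otimes> a = a [^] (s :: int) \<otimes> b"
  shows "b \<otimes> a [^] (j :: int) = a [^] (s * j) \<otimes> b"
proof (induction j rule: int_induct[of _ 0])
  case base
  show ?case
    using b by simp
next
  case (step1 j)
  have "b \<otimes> a [^] (j + 1) = (b \<otimes> a [^] j) \<otimes> a"
    using a b by (simp add: int_pow_mult m_assoc)
  also have "\<dots> = a [^] (s * j) \<otimes> (a [^] s \<otimes> b)"
    using a b by (simp add: step1 m_assoc ba)
  also have "\<dots> = a [^] (s * (j + 1)) \<otimes> b"
    using a b by (simp add: int_pow_mult m_assoc distrib_left)
  finally show ?case .
next
  case (step2 j)
  \<comment> \<open>Multiplying by \<open>a\<close> on the right reduces the downward step to the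
    induction hypothesis; cancelling \<open>a\<close> then gives the claim.\<close>
  have "(b \<otimes> a [^] (j - 1)) \<otimes> a = b \<otimes> a [^] (j - 1 + 1)"
    using a b int_pow_mult[of a "j - 1" 1] by (simp add: m_assoc)
  also have "\<dots> = a [^] (s * (j - 1) + s) \<otimes> b"
    by (simp add: step2 algebra_simps)
  also have "\<dots> = (a [^] (s * (j - 1)) \<otimes> b) \<otimes> a"
    using a b by (simp only: int_pow_mult m_assoc ba int_pow_closed)
  finally show ?case
    using a b by simp
qed

lemma twisted_group_pow:
  assumes "n > 0" "n dvd s * s - 1"
  shows "(1 mod n, False) [^]\<^bsub>twisted_group n s\<^esub> (i :: int) = (i mod n, False)"
proof -
  interpret group "twisted_group n s"
    using assms by (rule group_twisted_group)
  have a: "(1 mod n, False) \<in> carrier (twisted_group n s)"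
    using assms by (simp add: twisted_group_sel)
  have inv: "inv\<^bsub>twisted_group n s\<^esub> (1 mod n, False) = ((- 1) mod n, False)"
    by (rule inv_equality) (use assms in \<open>auto simp: twisted_group_sel mod_simps\<close>)
  show ?thesis
  proof (induction i rule: int_induct[of _ 0])
    case base
    show ?case
      by (simp add: twisted_group_sel)
  next
    case (step1 i)
    then show ?case
      using a by (simp add: int_pow_mult twisted_group_sel mod_simps)
  next
    case (step2 i)
    then show ?case
      using a by (simp add: int_pow_diff inv twisted_group_sel mod_simps)
  qed
qed

section \<open>Words in presented groups and in the model\<close>

lemma word_class_word_pow:
  "word_class R (word_pow w k) = word_class R w [^]\<^bsub>presented_group R\<^esub> k"
proof -
  interpret group "presented_group R"
    by (rule group_presented_group)
  have w: "word_class R w \<in> carrier (presented_group R)"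
    by (simp add: presented_group_simps)
  show ?thesis
  proof (induction k)
    case 0
    show ?case
      by (simp add: word_pow_def presented_group_simps)
  next
    case (Suc k)
    have "word_class R (word_pow w (Suc k))
        = word_class R w \<otimes>\<^bsub>presented_group R\<^esub> word_class R (word_pow w k)"
      by (simp add: word_pow_def presented_group_simps)
    then show ?case
      using Suc nat_pow_Suc2[OF w] by simp
  qed
qed

lemma word_class_word_inv:
  "word_class R (word_inv w) = inv\<^bsub>presented_group R\<^esub> word_class R w"
proof -
  interpret group "presented_group R"
    by (rule group_presented_group)
  show ?thesis
    by (rule inv_equality[symmetric])
      (simp_all add: presented_group_simps(2,3) word_class_eq_iff word_inv_left,
        simp_all add: presented_group_simps(1))
qed

lemma word_eval_word_pow:
  assumes "group H" "range f \<subseteq> carrier H"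
  shows "word_eval H f (word_pow w k) = word_eval H f w [^]\<^bsub>H\<^esub> k"
proof -
  interpret group H
    by fact
  show ?thesis
  proof (induction k)
    case 0
    show ?case
      by (simp add: word_pow_def word_eval_def)
  next
    case (Suc k)
    have "word_eval H f (word_pow w (Suc k)) = word_eval H f w \<otimes>\<^bsub>H\<^esub> word_eval H f (word_pow w k)"
      using word_eval_append[OF assms] by (simp add: word_pow_def)
    then show ?case
      using Suc word_eval_closed[OF assms] nat_pow_Suc2 by simp
  qed
qed

text \<open>The exponent is \<open>1 mod n\<close> because for \<open>n = 1\<close>, that is
  \<open>p = 0\<close>, the exponent 1 lies outside the carrier.\<close>

definition twisted_gen :: "int \<Rightarrow> two_gens \<Rightarrow> int \<times> bool" where
  "twisted_gen n g = (case g of Gen1 \<Rightarrow> (1 mod n, False) | Gen2 \<Rightarrow> (0, True))"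

lemma range_twisted_gen: "n > 0 \<Longrightarrow> range (twisted_gen n) \<subseteq> carrier (twisted_group n s)"
  by (auto simp: twisted_gen_def twisted_group_sel split: two_gens.splits)

text \<open>The relations bring every word into the form a^i b^e, which yields the multiplication
  rule and the carrier. That these forms are distinct comes from a homomorphism into
  \<open>twisted_group\<close>, which exists because the generators of the model satisfy the
  relations.\<close>

lemma dihedral_like_presented_group:
  fixes p :: nat and s :: int and R
  defines "G \<equiv> presented_group R"
  defines "a \<equiv> word_class R (gen Gen1)" and "b \<equiv> word_class R (gen Gen2)"
  assumes an: "a [^]\<^bsub>G\<^esub> (2 ^ p :: nat) = \<one>\<^bsub>G\<^esub>" and bb: "b \<otimes>\<^bsub>G\<^esub> b = \<one>\<^bsub>G\<^esub>"
    and ba: "b \<otimes>\<^bsub>G\<^esub> a = a [^]\<^bsub>G\<^esub> s \<otimes>\<^bsub>G\<^esub> b"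
    and s: "4 dvd s + 1" "2 ^ p dvd s * s - 1"
    and model: "\<And>r t. (r, t) \<in> R \<Longrightarrow> word_eval (twisted_group (2 ^ p) s) (twisted_gen (2 ^ p)) r
      = word_eval (twisted_group (2 ^ p) s) (twisted_gen (2 ^ p)) t"
  shows "dihedral_like G p s (\<lambda>i e. a [^]\<^bsub>G\<^esub> i \<otimes>\<^bsub>G\<^esub> (if e then b else \<one>\<^bsub>G\<^esub>))"
proof -
  interpret G: group G
    unfolding G_def by (rule group_presented_group)
  let ?M = "twisted_group (2 ^ p) s"
  interpret M: group ?M
    using s by (intro group_twisted_group) auto
  let ?\<phi> = "\<lambda>i e. a [^]\<^bsub>G\<^esub> (i :: int) \<otimes>\<^bsub>G\<^esub> (if e then b else \<one>\<^bsub>G\<^esub>)"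
  have a: "a \<in> carrier G" and b: "b \<in> carrier G"
    by (simp_all add: a_def b_def G_def presented_group_simps)
  have gens: "range (twisted_gen (2 ^ p)) \<subseteq> carrier ?M"
    by (rule range_twisted_gen) simp
  obtain h where h: "h \<in> hom G ?M" and
    h_word: "\<And>w. h (word_class R w) = word_eval ?M (twisted_gen (2 ^ p)) w"
    using presented_group_universal[OF M.is_group gens model] unfolding G_def by blast
  interpret h: group_hom G ?M h
    by unfold_locales (rule h)
  have ha: "h a = (1 mod 2 ^ p, False)" and hb: "h b = (0, True)"
    by (simp_all add: a_def b_def h_word word_eval_def gen_def twisted_gen_def twisted_group_sel)
  \<comment> \<open>The model reads off the exponent modulo \<open>2 ^ p\<close> and the reflection
    flag, so equal elements agree in both.\<close>
  have h\<phi>: "h (?\<phi> i e) = (i mod 2 ^ p, e)" for i e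
  proof -
    have "h (a [^]\<^bsub>G\<^esub> i) = (i mod 2 ^ p, False)"
      using a s twisted_group_pow[of "2 ^ p" s i] by (simp only: h.hom_int_pow ha) simp
    then show ?thesis
      using a b by (simp add: hb twisted_group_sel)
  qed
  have mult: "?\<phi> i e \<otimes>\<^bsub>G\<^esub> ?\<phi> j f = ?\<phi> (i + (if e then s * j else j)) (e \<noteq> f)" for i e j f
  proof (cases e)
    case True
    let ?c = "if f then b else \<one>\<^bsub>G\<^esub>"
    have c: "?c \<in> carrier G"
      using b by simp
    have "?\<phi> i e \<otimes>\<^bsub>G\<^esub> ?\<phi> j f = a [^]\<^bsub>G\<^esub> i \<otimes>\<^bsub>G\<^esub> ((b \<otimes>\<^bsub>G\<^esub> a [^]\<^bsub>G\<^esub> j) \<otimes>\<^bsub>G\<^esub> ?c)"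
      using a b c True by (simp add: G.m_assoc)
    also have "\<dots> = a [^]\<^bsub>G\<^esub> (i + s * j) \<otimes>\<^bsub>G\<^esub> (b \<otimes>\<^bsub>G\<^esub> ?c)"
      using a b c by (simp add: G.conj_int_pow[OF a b ba] G.m_assoc G.int_pow_mult)
    also have "b \<otimes>\<^bsub>G\<^esub> ?c = (if e \<noteq> f then b else \<one>\<^bsub>G\<^esub>)"
      using True b bb by simp
    finally show ?thesis
      using True by simp
  next
    case False
    then show ?thesis
      using a b by (simp add: G.m_assoc G.int_pow_mult)
  qed
  have eq_iff: "?\<phi> i e = ?\<phi> j f \<longleftrightarrow> e = f \<and> 2 ^ p dvd i - j" for i e j f
  proof
    assume "?\<phi> i e = ?\<phi> j f"
    then have "(i mod 2 ^ p, e) = (j mod 2 ^ p, f)"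
      using h\<phi> by metis
    then show "e = f \<and> 2 ^ p dvd i - j"
      by (simp add: mod_eq_dvd_iff)
  next
    assume *: "e = f \<and> 2 ^ p dvd i - j"
    then obtain q where "i - j = 2 ^ p * q"
      by blast
    then have "i = int (2 ^ p) * q + j"
      by simp
    moreover have "a [^]\<^bsub>G\<^esub> (int (2 ^ p) * q) = \<one>\<^bsub>G\<^esub>"
      using G.int_pow_pow[OF a, of "int (2 ^ p)" q] an
      by (simp only: int_pow_int G.int_pow_one)
    ultimately have "a [^]\<^bsub>G\<^esub> i = a [^]\<^bsub>G\<^esub> j"
      using a by (simp add: G.int_pow_mult)
    then show "?\<phi> i e = ?\<phi> j f"
      using * by simp
  qed
  have letter: "word_class R [(x, c)] \<in> range (case_prod ?\<phi>)" for x c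
  proof -
    have inv: "word_class R [(x, False)] = inv\<^bsub>G\<^esub> word_class R (gen x)" for x
      using word_class_word_inv[of R "gen x"] by (simp add: G_def gen_def word_inv_def)
    have pos: "word_class R [(x, True)] = word_class R (gen x)" for x
      by (simp add: gen_def)
    \<comment> \<open>Since b is its own inverse, negative letters have normal forms as
      well.\<close>
    have "inv\<^bsub>G\<^esub> b = b"
      using b bb by (intro G.inv_equality)
    then have "word_class R [(x, c)] = ?\<phi> (case x of Gen1 \<Rightarrow> if c then 1 else - 1 | Gen2 \<Rightarrow> 0) (x = Gen2)"
      using a b by (cases x; cases c) (simp_all add: inv pos G.int_pow_neg flip: a_def b_def)
    then show ?thesis
      by (intro range_eqI[where x = "(_, _)"]) (simp only: prod.case)
  qed
  have "word_class R w \<in> range (case_prod ?\<phi>)" for w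
  proof (induction w)
    case Nil
    have "word_class R [] = ?\<phi> 0 False"
      by (simp add: G_def presented_group_simps)
    then show ?case
      by (intro range_eqI[where x = "(_, _)"]) (simp only: prod.case)
  next
    case (Cons l w)
    obtain i e j f where "word_class R [l] = ?\<phi> i e" "word_class R w = ?\<phi> j f"
      using Cons letter[of "fst l" "snd l"] by auto
    then have "word_class R (l # w) = ?\<phi> (i + (if e then s * j else j)) (e \<noteq> f)"
      using presented_group_simps(2)[of R "[l]" w] mult[of i e j f] by (simp add: G_def)
    then show ?case
      by (intro range_eqI[where x = "(_, _)"]) (simp only: prod.case)
  qed
  moreover have "?\<phi> i e \<in> carrier G" for i e
    using a b by simp
  ultimately have "carrier G = range (case_prod ?\<phi>)"
    unfolding G_def presented_group_simps(1) by auto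
  then show ?thesis
    using mult eq_iff s(1) by unfold_locales auto
qed

text \<open>These rules reduce checking a relation in the model to arithmetic modulo
  \<open>n\<close>. Both signs of \<open>Gen2\<close> evaluate alike, as the reflection is an
  involution.\<close>

lemma word_eval_twisted_gen:
  fixes n s :: int
  assumes "n > 0" "n dvd s * s - 1"
  shows "word_eval (twisted_group n s) (twisted_gen n) [] = (0, False)"
    and "word_eval (twisted_group n s) (twisted_gen n) ((Gen1, c) # w) =
      (if c then (1 mod n, False) else ((- 1) mod n, False))
        \<otimes>\<^bsub>twisted_group n s\<^esub> word_eval (twisted_group n s) (twisted_gen n) w"
    and "word_eval (twisted_group n s) (twisted_gen n) ((Gen2, c) # w) =
      (0, True) \<otimes>\<^bsub>twisted_group n s\<^esub> word_eval (twisted_group n s) (twisted_gen n) w"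
    and "word_eval (twisted_group n s) (twisted_gen n) (word_pow (gen Gen1) k) = (int k mod n, False)"
    and "word_eval (twisted_group n s) (twisted_gen n) (word_pow (gen Gen2) 2) = (0, False)"
proof -
  interpret group "twisted_group n s"
    using assms by (rule group_twisted_group)
  have "inv\<^bsub>twisted_group n s\<^esub> (1 mod n, False) = ((- 1) mod n, False)"
    "inv\<^bsub>twisted_group n s\<^esub> (0, True) = (0, True)"
    by (rule inv_equality; use assms in \<open>auto simp: twisted_group_sel mod_simps\<close>)+
  then show
    "word_eval (twisted_group n s) (twisted_gen n) ((Gen1, c) # w) =
      (if c then (1 mod n, False) else ((- 1) mod n, False))
        \<otimes>\<^bsub>twisted_group n s\<^esub> word_eval (twisted_group n s) (twisted_gen n) w"
    "word_eval (twisted_group n s) (twisted_gen n) ((Gen2, c) # w) =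
      (0, True) \<otimes>\<^bsub>twisted_group n s\<^esub> word_eval (twisted_group n s) (twisted_gen n) w"
    by (simp_all add: word_eval_def twisted_gen_def)
  show "word_eval (twisted_group n s) (twisted_gen n) [] = (0, False)"
    by (simp add: word_eval_def twisted_group_sel)
  have "word_eval (twisted_group n s) (twisted_gen n) (gen Gen1) = (1 mod n, False)"
    by (simp add: word_eval_def gen_def twisted_gen_def twisted_group_sel)
  then show "word_eval (twisted_group n s) (twisted_gen n) (word_pow (gen Gen1) k)
      = (int k mod n, False)"
    using word_eval_word_pow[OF is_group range_twisted_gen[OF assms(1)], of "gen Gen1" k]
      twisted_group_pow[OF assms, of "int k"]
    by (simp add: int_pow_int)
  show "word_eval (twisted_group n s) (twisted_gen n) (word_pow (gen Gen2) 2) = (0, False)"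
    by (simp add: word_pow_def gen_def numeral_2_eq_2 word_eval_def twisted_gen_def
        twisted_group_sel)
qed

section \<open>The dihedral and quasi-dihedral groups as instances\<close>

lemma dihedral_like_dihedral_group:
  "\<exists>\<phi>. dihedral_like (dihedral_group (2 ^ p)) p (- 1) \<phi>"
proof -
  define R where "R = {(word_pow (gen Gen1) (2 ^ p), []), (word_pow (gen Gen2) 2, []),
    (gen Gen1 @ gen Gen2, gen Gen2 @ word_inv (gen Gen1))}"
  define G where "G = presented_group R"
  define a where "a = word_class R (gen Gen1)"
  define b where "b = word_class R (gen Gen2)"
  interpret G: group G
    unfolding G_def by (rule group_presented_group)
  have a: "a \<in> carrier G" and b: "b \<in> carrier G"
    by (simp_all add: a_def b_def G_def presented_group_simps)
  have rel: "word_class R r = word_class R t" if "(r, t) \<in> R" for r t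
    using word_eq.rel[OF that, of "[]" "[]"] by (simp add: word_class_eq_iff)
  have an: "a [^]\<^bsub>G\<^esub> (2 ^ p :: nat) = \<one>\<^bsub>G\<^esub>"
    unfolding a_def G_def word_class_word_pow[symmetric] presented_group_simps
    by (rule rel) (simp add: R_def)
  have "b [^]\<^bsub>G\<^esub> (2 :: nat) = \<one>\<^bsub>G\<^esub>"
    unfolding b_def G_def word_class_word_pow[symmetric] presented_group_simps
    by (rule rel) (simp add: R_def)
  then have bb: "b \<otimes>\<^bsub>G\<^esub> b = \<one>\<^bsub>G\<^esub>"
    using b by (simp add: numeral_2_eq_2)
  have "a \<otimes>\<^bsub>G\<^esub> b = b \<otimes>\<^bsub>G\<^esub> inv\<^bsub>G\<^esub> a"
    unfolding a_def b_def G_def word_class_word_inv[symmetric] presented_group_simps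
    by (rule rel) (simp add: R_def)
  \<comment> \<open>Multiplying the defining relation by the inverse of \<open>a\<close> on the left
    and by \<open>a\<close> on the right gives the rule for moving \<open>b\<close> past
    \<open>a\<close>.\<close>
  then have "inv\<^bsub>G\<^esub> a \<otimes>\<^bsub>G\<^esub> (a \<otimes>\<^bsub>G\<^esub> b) \<otimes>\<^bsub>G\<^esub> a = inv\<^bsub>G\<^esub> a \<otimes>\<^bsub>G\<^esub> (b \<otimes>\<^bsub>G\<^esub> inv\<^bsub>G\<^esub> a) \<otimes>\<^bsub>G\<^esub> a"
    by simp
  then have "b \<otimes>\<^bsub>G\<^esub> a = inv\<^bsub>G\<^esub> a \<otimes>\<^bsub>G\<^esub> b"
    using a b by (simp add: G.m_assoc flip: G.m_assoc[of "inv\<^bsub>G\<^esub> a" a])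
  then have ba: "b \<otimes>\<^bsub>G\<^esub> a = a [^]\<^bsub>G\<^esub> (- 1 :: int) \<otimes>\<^bsub>G\<^esub> b"
    using a by (simp add: G.int_pow_neg)
  let ?eval = "word_eval (twisted_group (2 ^ p) (- 1)) (twisted_gen (2 ^ p))"
  have "?eval (word_pow (gen Gen1) (2 ^ p)) = ?eval []" "?eval (word_pow (gen Gen2) 2) = ?eval []"
    by (simp_all add: word_eval_twisted_gen)
  moreover have "?eval (gen Gen1 @ gen Gen2) = ?eval (gen Gen2 @ word_inv (gen Gen1))"
    by (simp add: word_eval_twisted_gen gen_def word_inv_def twisted_group_sel mod_simps)
  ultimately have "?eval r = ?eval t" if "(r, t) \<in> R" for r t
    using that unfolding R_def by blast
  then have "dihedral_like G p (- 1) (\<lambda>i e. a [^]\<^bsub>G\<^esub> i \<otimes>\<^bsub>G\<^esub> (if e then b else \<one>\<^bsub>G\<^esub>))"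
    using an bb ba unfolding G_def a_def b_def by (intro dihedral_like_presented_group) auto
  moreover have "G = dihedral_group (2 ^ p)"
    by (simp add: G_def R_def dihedral_group_def Let_def)
  ultimately show ?thesis
    by blast
qed

lemma dihedral_like_quasidihedral_group:
  assumes \<alpha>: "\<alpha> > 3"
  shows "\<exists>\<phi>. dihedral_like (quasidihedral_group \<alpha>) (\<alpha> - 1) (2 ^ (\<alpha> - 2) - 1) \<phi>"
proof -
  define R where "R = {(word_pow (gen Gen1) (2 ^ (\<alpha> - 1)), []), (word_pow (gen Gen2) 2, []),
    (gen Gen2 @ gen Gen1 @ word_inv (gen Gen2), word_pow (gen Gen1) (2 ^ (\<alpha> - 2) - 1))}"
  define G where "G = presented_group R"
  define a where "a = word_class R (gen Gen1)"
  define b where "b = word_class R (gen Gen2)"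
  define s :: int where "s = 2 ^ (\<alpha> - 2) - 1"
  \<comment> \<open>The relation uses a natural exponent. The truncated subtraction is exact because
    the power of two is at least 1, so \<open>N\<close> agrees with the integer
    \<open>s\<close>.\<close>
  define N :: nat where "N = 2 ^ (\<alpha> - 2) - 1"
  have sN: "s = int N"
    by (simp add: s_def N_def of_nat_diff)
  interpret G: group G
    unfolding G_def by (rule group_presented_group)
  have a: "a \<in> carrier G" and b: "b \<in> carrier G"
    by (simp_all add: a_def b_def G_def presented_group_simps)
  have rel: "word_class R r = word_class R t" if "(r, t) \<in> R" for r t
    using word_eq.rel[OF that, of "[]" "[]"] by (simp add: word_class_eq_iff)
  have an: "a [^]\<^bsub>G\<^esub> (2 ^ (\<alpha> - 1) :: nat) = \<one>\<^bsub>G\<^esub>"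
    unfolding a_def G_def word_class_word_pow[symmetric] presented_group_simps
    by (rule rel) (simp add: R_def)
  have "b [^]\<^bsub>G\<^esub> (2 :: nat) = \<one>\<^bsub>G\<^esub>"
    unfolding b_def G_def word_class_word_pow[symmetric] presented_group_simps
    by (rule rel) (simp add: R_def)
  then have bb: "b \<otimes>\<^bsub>G\<^esub> b = \<one>\<^bsub>G\<^esub>"
    using b by (simp add: numeral_2_eq_2)
  have "b \<otimes>\<^bsub>G\<^esub> (a \<otimes>\<^bsub>G\<^esub> inv\<^bsub>G\<^esub> b) = a [^]\<^bsub>G\<^esub> N"
    unfolding a_def b_def G_def word_class_word_inv[symmetric] word_class_word_pow[symmetric]
      presented_group_simps
    by (rule rel) (simp add: R_def N_def)
  then have "b \<otimes>\<^bsub>G\<^esub> (a \<otimes>\<^bsub>G\<^esub> inv\<^bsub>G\<^esub> b) \<otimes>\<^bsub>G\<^esub> b = a [^]\<^bsub>G\<^esub> N \<otimes>\<^bsub>G\<^esub> b"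
    by simp
  then have ba: "b \<otimes>\<^bsub>G\<^esub> a = a [^]\<^bsub>G\<^esub> s \<otimes>\<^bsub>G\<^esub> b"
    using a b by (simp add: G.m_assoc sN int_pow_int)
  \<comment> \<open>Now \<open>s = 4 * 2 ^ m - 1\<close>, which makes both divisibility conditions
    on \<open>s\<close> explicit factorizations.\<close>
  obtain m where m: "\<alpha> = m + 4"
    using that[of "\<alpha> - 4"] \<alpha> by simp
  have s4: "4 dvd s + 1"
    by (simp add: s_def m power_add)
  have "s * s - 1 = 2 ^ (\<alpha> - 1) * (2 * 2 ^ m - 1)"
    by (simp add: s_def m power_add algebra_simps)
  then have s2: "2 ^ (\<alpha> - 1) dvd s * s - 1"
    by simp
  let ?eval = "word_eval (twisted_group (2 ^ (\<alpha> - 1)) s) (twisted_gen (2 ^ (\<alpha> - 1)))"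
  have "?eval (word_pow (gen Gen1) (2 ^ (\<alpha> - 1))) = ?eval []"
    "?eval (word_pow (gen Gen2) 2) = ?eval []"
    using s2 by (simp_all add: word_eval_twisted_gen)
  moreover have "?eval (gen Gen2 @ gen Gen1 @ word_inv (gen Gen2)) = (s mod 2 ^ (\<alpha> - 1), False)"
    using s2
    by (simp add: word_eval_twisted_gen gen_def word_inv_def twisted_group_sel mod_simps)
  then have "?eval (gen Gen2 @ gen Gen1 @ word_inv (gen Gen2)) = ?eval (word_pow (gen Gen1) N)"
    using s2 by (simp only: word_eval_twisted_gen zero_less_power zero_less_numeral sN)
  ultimately have "?eval r = ?eval t" if "(r, t) \<in> R" for r t
    using that unfolding R_def N_def by blast
  then have "dihedral_like G (\<alpha> - 1) s (\<lambda>i e. a [^]\<^bsub>G\<^esub> i \<otimes>\<^bsub>G\<^esub> (if e then b else \<one>\<^bsub>G\<^esub>))"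
    using an bb ba s4 s2 unfolding G_def a_def b_def by (intro dihedral_like_presented_group) auto
  moreover have "G = quasidihedral_group \<alpha>"
    by (simp add: G_def R_def quasidihedral_group_def Let_def)
  ultimately show ?thesis
    unfolding s_def by blast
qed

section \<open>The isomorphism\<close>

lemma nonnormal_perm_graph_dihedral_group:
  "\<exists>f. graph_iso_map f (index_graph {(k, i). 2 \<le> k \<and> k \<le> p \<and> i < 2 ^ k})
    (nonnormal_perm_graph (dihedral_group (2 ^ p)))"
proof -
  obtain \<phi> where "dihedral_like (dihedral_group (2 ^ p)) p (- 1) \<phi>"
    using dihedral_like_dihedral_group by blast
  then interpret dihedral_like "dihedral_group (2 ^ p)" p "- 1" \<phi> .
  show ?thesis
    using graph_iso_map_index_graph by (auto simp: nonnormal_indices_def)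
qed

text \<open>Here \<open>s + 1 = 2 ^ (\<alpha> - 2)\<close>, so closure holds for every index up to
  level \<open>\<alpha> - 2\<close>, and at the top level \<open>\<alpha> - 1\<close> exactly for
  the even ones.\<close>

lemma nonnormal_perm_graph_quasidihedral_group:
  assumes \<alpha>: "\<alpha> > 3"
  shows "\<exists>f. graph_iso_map f
    (index_graph {(k, i). 2 \<le> k \<and> i < 2 ^ k \<and> (if even i then k \<le> \<alpha> - 1 else k \<le> \<alpha> - 2)})
    (nonnormal_perm_graph (quasidihedral_group \<alpha>))"
proof -
  obtain \<phi> where "dihedral_like (quasidihedral_group \<alpha>) (\<alpha> - 1) (2 ^ (\<alpha> - 2) - 1) \<phi>"
    using dihedral_like_quasidihedral_group[OF \<alpha>] by blast
  then interpret dihedral_like "quasidihedral_group \<alpha>" "\<alpha> - 1" "2 ^ (\<alpha> - 2) - 1" \<phi> .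
  have iff: "k \<le> \<alpha> - 1 \<and> (2::int) ^ k dvd 2 ^ (\<alpha> - 2) * int i
      \<longleftrightarrow> (if even i then k \<le> \<alpha> - 1 else k \<le> \<alpha> - 2)" for k i
  proof (cases "k \<le> \<alpha> - 2")
    case True
    then show ?thesis
      using \<alpha> by (auto intro: dvd_mult2 le_imp_power_dvd)
  next
    case False
    have "(2::int) ^ (\<alpha> - 1) dvd 2 ^ (\<alpha> - 2) * int i \<longleftrightarrow> even i"
    proof -
      have "(2::int) ^ (\<alpha> - 1) = 2 ^ (\<alpha> - 2) * 2"
        using \<alpha> by (simp flip: power_Suc2 add: Suc_diff_Suc numeral_2_eq_2)
      then show ?thesis
        by simp
    qed
    moreover have "k \<le> \<alpha> - 1 \<longleftrightarrow> k = \<alpha> - 1"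
      using False by linarith
    ultimately show ?thesis
      using False by auto
  qed
  have indices: "nonnormal_indices (\<alpha> - 1) (2 ^ (\<alpha> - 2) - 1)
      = {(k, i). 2 \<le> k \<and> i < 2 ^ k \<and> (if even i then k \<le> \<alpha> - 1 else k \<le> \<alpha> - 2)}"
    unfolding nonnormal_indices_def iff[symmetric] by auto
  show ?thesis
    using graph_iso_map_index_graph unfolding indices by blast
qed

lemma join_nonnormal_perm_graph_dihedral_group:
  assumes "p \<ge> 1"
  shows "\<exists>f. graph_iso_map f (index_graph {(k, i). 1 \<le> k \<and> k \<le> p \<and> i < 2 ^ k})
    (graph_join (complete_graph 2) (nonnormal_perm_graph (dihedral_group (2 ^ p))))"
proof -
  obtain f where f: "graph_iso_map f (index_graph {(k, i). 2 \<le> k \<and> k \<le> p \<and> i < 2 ^ k})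
      (nonnormal_perm_graph (dihedral_group (2 ^ p)))"
    using nonnormal_perm_graph_dihedral_group by blast
  have "graph_iso_map id (complete_graph 2) (complete_graph 2)"
    by (simp add: graph_iso_map_def)
  then show ?thesis
    using f join_complete_graph_index_graph[OF assms]
    by (blast intro: graph_iso_map_join graph_iso_map_inv graph_iso_map_trans)
qed

lemma graph_join_empty:
  assumes "pverts H = {}"
  shows "graph_iso_map (case_sum (\<lambda>u. u) h) (graph_join G H) G"
  using assms by (auto simp: graph_iso_map_def graph_join_sel bij_betw_def inj_on_def Plus_def image_image)

theorem theorem6p1:
  fixes \<alpha> :: nat
  assumes "\<alpha> > 3"
  shows "graph_isomorphic
      (nonnormal_perm_graph (quasidihedral_group \<alpha>))
      (graph_union
        (graph_join (complete_graph 2)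
          (nonnormal_perm_graph (dihedral_group (2 ^ (\<alpha> - 2)))))
        (graph_join (complete_graph 2)
          (nonnormal_perm_graph (dihedral_group (2 ^ (\<alpha> - 3))))))
    \<and> (\<alpha> = 4 \<longrightarrow>
        pverts (nonnormal_perm_graph (dihedral_group (2 ^ (\<alpha> - 3)))) = {} \<and>
        graph_isomorphic
          (graph_join (complete_graph 2)
            (nonnormal_perm_graph (dihedral_group (2 ^ (\<alpha> - 3)))))
          (complete_graph 2))"
proof (intro conjI impI)
  let ?\<Gamma> = "\<lambda>p. nonnormal_perm_graph (dihedral_group (2 ^ p))"
  let ?J = "\<lambda>p. graph_join (complete_graph 2) (?\<Gamma> p)"
  have simple_J: "pair_bidirected_digraph (?J p)" for p
    by (intro graph_join_simple complete_graph_simple nonnormal_perm_graph_simple)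
  have "\<alpha> - 2 \<ge> 1" "\<alpha> - 3 \<ge> 1"
    using assms by simp_all
  then obtain f g where
    fg: "graph_iso_map f (index_graph {(k, i). 1 \<le> k \<and> k \<le> \<alpha> - 2 \<and> i < 2 ^ k}) (?J (\<alpha> - 2))"
      "graph_iso_map g (index_graph {(k, i). 1 \<le> k \<and> k \<le> \<alpha> - 3 \<and> i < 2 ^ k}) (?J (\<alpha> - 3))"
    using join_nonnormal_perm_graph_dihedral_group by meson
  obtain h where h: "graph_iso_map h
      (index_graph {(k, i). 2 \<le> k \<and> i < 2 ^ k \<and> (if even i then k \<le> \<alpha> - 1 else k \<le> \<alpha> - 2)})
      (nonnormal_perm_graph (quasidihedral_group \<alpha>))"
    using nonnormal_perm_graph_quasidihedral_group[OF assms] by blast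
  \<comment> \<open>Halving lowers the bounds \<open>\<alpha> - 1\<close> for even and
    \<open>\<alpha> - 2\<close> for odd indices to \<open>\<alpha> - 2\<close> and
    \<open>\<alpha> - 3\<close>, the exponents of the two dihedral groups.\<close>
  have "Suc (\<alpha> - 2) = \<alpha> - 1" "Suc (\<alpha> - 3) = \<alpha> - 2"
    using assms by simp_all
  note split = index_graph_split_parity[of "\<alpha> - 2" "\<alpha> - 3", unfolded this]
  show "graph_isomorphic (nonnormal_perm_graph (quasidihedral_group \<alpha>))
      (graph_union (?J (\<alpha> - 2)) (?J (\<alpha> - 3)))"
    by (rule graph_isomorphicI[OF graph_iso_map_trans[OF graph_iso_map_inv[OF h]
          graph_iso_map_trans[OF split graph_iso_map_union[OF fg]]]])
      (intro nonnormal_perm_graph_simple graph_union_simple simple_J)+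
  \<comment> \<open>The levels of the second dihedral group would have to lie between 2 and 1, so
    its index set is empty and the join reduces to the complete graph.\<close>
  assume \<alpha>4: "\<alpha> = 4"
  obtain e where "graph_iso_map e (index_graph {(k, i). 2 \<le> k \<and> k \<le> \<alpha> - 3 \<and> i < 2 ^ k})
      (?\<Gamma> (\<alpha> - 3))"
    using nonnormal_perm_graph_dihedral_group by blast
  then show empty: "pverts (?\<Gamma> (\<alpha> - 3)) = {}"
    by (auto simp: \<alpha>4 graph_iso_map_def index_graph_sel bij_betw_def)
  show "graph_isomorphic (?J (\<alpha> - 3)) (complete_graph 2)"
    using empty simple_J complete_graph_simple by (blast intro: graph_isomorphicI graph_join_empty)
qed

end
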